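(* Fix $\alpha\in(0,1)$ and assume (Boundedness), (Density), (Known covariate shift) and (Smoothness), stated in the context. Let the raw endpoints $\widetilde f_{n,\tau}$, $\tau\in\{\alpha/2,1-\alpha/2\}$, be measurable empirical pinball risk minimizers over $\mathcal F_n^{\rm SH}$, and use the fitted endpoints obtained by pointwise sorting. There is a constant $C$ depending only on $(\alpha,\mu_{\rm low},\mu_{\rm up},\beta,d,M,L_\beta)$, and not on $(n,m,\delta,w,w_{\max})$, such that for every $\delta\in(0,1)$, every $n\ge n_{\rm SH}$ and $m\ge1$ satisfying $$2\mu_{\rm up}w_{\max}^{1/2}\epsilon_2(n,\delta/4)+(2-\alpha)\eta^w_m(\delta)<2\mu_{\rm low}r_-,$$ $$2\mu_{\rm up}w_{\max}^{1/2}\epsilon_2(n,\delta/4)+(2-\alpha)\eta^w_m(\delta)+\frac{(1-\alpha)w_{\max}}m\le2\mu_{\rm low}r_+,$$ with probability at least $1-\delta$ over $(\mathcal D^{\rm tr}_n,\mathcal D^{\rm cal}_m)$, $$\max\Bigl\{\bigl\||\hat{\mathcal C}^w_\alpha(\cdot)|-|\mathcal C^\star_\alpha(\cdot)|\bigr\|_{L^2(Q_X)},\ \bigl\|\mathrm{Cov}_{\hat{\mathcal C}^w_\alpha}(\cdot)-(1-\alpha)\bigr\|_{L^2(Q_X)}\Bigr\}$$ $$\le C\Bigl[w_{\max}^{1/2}\Bigl\{n^{-\beta/(2\beta+d)}(\log n)^{3/2}+\sqrt{\tfrac{\log(4/\delta)}n}\Bigr\}+(2-\alpha)\eta^w_m(\delta)+\frac{1-\alpha}m\sqrt{w_{\max}\bigl(1+\chi^2(Q_X\Vert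 P_X)\bigr)}\Bigr].$$
   Context: Data: $P_X$ is a probability measure on $\mathcal X$, $P_{Y\mid X}$ a conditional kernel, $P_{XY}=P_X\otimes P_{Y\mid X}$; $\mathcal D^{\rm tr}_n\sim P_{XY}^{\otimes n}$ and $\mathcal D^{\rm cal}_m=\{(X_j,Y_j)\}_{j=1}^m\sim P_{XY}^{\otimes m}$ independent. $f^\star_\tau(x)=\inf\{t:P_{Y\mid X=x}((-\infty,t])\ge\tau\}$; $\mathcal C^\star_\alpha(x)=[f^\star_{\alpha/2}(x),f^\star_{1-\alpha/2}(x)]$; $|\cdot|$ of a set is Lebesgue length; $\mathrm{Cov}_C(x)=P_{Y\mid X=x}(C(x))$ for fixed data. (Boundedness) $\mathcal X=[0,1]^d$ and $Y$ takes values in $\mathcal Y=[-M,M]$, $M>0$. (Density) For every $x\in\mathcal X$, $P_{Y\mid X=x}$ has support $\mathcal Y$ and a Lebesgue density with $0<\mu_{\rm low}\le p_{Y\mid X}(y\mid x)\le\mu_{\rm up}<\infty$ for every $y\in\mathcal Y$. (Known covariate shift) $Q_X$ is a probability measure on $\mathcal X$ with $Q_X\ll P_X$; the likelihood ratio $w=dQ_X/dP_X$ and a deterministic $w_{\max}<\infty$ with $0\le w\le w_{\max}$ are known. $\chi^2(Q_X\Vert P_X)=\int(w-1)^2dP_X$. (Smoothness) For each $\tau\in\{\alpha/2,1-\alpha/2\}$, $f^\star_\tau\in\mathcal H^\beta(\mathcal X,L_\beta)$ for some $\beta>0$, where with $k_\beta=\lceil\beta\rceil-1$, $\mathcal H^\beta(\Omega,H)$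 is the set of $f:\Omega\to\mathbb R$ with $\sum_{|\gamma|\le k_\beta}\|\partial^\gamma f\|_\infty+\sum_{|\gamma|=k_\beta}\sup_{x\ne y}\frac{|\partial^\gamma f(x)-\partial^\gamma f(y)|}{\|x-y\|_\infty^{\beta-k_\beta}}\le H$. Pinball loss $\rho_\tau(u)=u(\tau-\mathbf 1\{u<0\})$; empirical risk = average of $\rho_\tau(Y-f(X))$ over $\mathcal D^{\rm tr}_n$. Sparse-ReLU class. $\sigma(t)=\max(t,0)$, $\sigma_{\mathbf v}(\mathbf y)=(\sigma(y_i-v_i))_i$. For depth $L$ and widths $\mathbf p=(p_0,\dots,p_{L+1})$, $p_0=d$, $p_{L+1}=1$: $f_\theta(x)=W_Lh_L(x)$, $h_0(x)=x$, $h_\ell(x)=\sigma_{\mathbf v_\ell}(W_{\ell-1}h_{\ell-1}(x))$, $1\le\ell\le L$, $W_\ell\in\mathbb R^{p_{\ell+1}\times p_\ell}$, $\mathbf v_\ell\in\mathbb R^{p_\ell}$, $\mathbf v_0=0$. With $T_M(x)=\min\{\max(x,-M),M\}$, $\mathcal F(L,\mathbf p,s,M)$ is the set of $T_M\circ f_\theta$ with all entries of all $W_j,\mathbf v_j$ in $[-1,1]$ and at most $s$ nonzero entries in total. $\mathcal F_n^{\rm SH}=\mathcal F(L_{\rm SH}(n),\mathbf p_{\rm SH}(n),S_{\rm SH}(n),M)$ with $N_n=\lceil n^{d/(2\beta+d)}\rceil$; $L_{\rm SH}(n)=8+(\lceil\log_2n\rceil+5)(1+\lceil\log_2(d\vee\beta)\rceil)$;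 $\mathbf p_{\rm SH}(n)=(d,W_{\rm SH}(n),\dots,W_{\rm SH}(n),1)$ with $L_{\rm SH}(n)$ hidden entries $W_{\rm SH}(n)=6(d+\lceil\beta\rceil)N_n$; $S_{\rm SH}(n)=\lceil141(d+\beta+1)^{3+d}N_n(\lceil\log_2n\rceil+6)\rceil$. Training threshold $n_{\rm SH}=\lceil(\beta+1)^{2\beta+d}\vee(L_\beta+1)^{(2\beta+d)/d}e^{2\beta+d}\vee e^{3(2\beta+d)/(2\beta)}\rceil$. Endpoint radius. $C_{\rm rate},C_{\rm conf}>0$ are fixed constants depending only on $(\alpha,\mu_{\rm low},\mu_{\rm up},\beta,d,M,L_\beta)$ such that, under (Boundedness), (Density), (Smoothness), for each $\tau\in\{\alpha/2,1-\alpha/2\}$, every $u\in(0,1)$ and $n\ge n_{\rm SH}$, with probability at least $1-u$, $\|\widetilde f_{n,\tau}-f^\star_\tau\|_{L^2(P_X)}\le C_{\rm rate}n^{-\beta/(2\beta+d)}(\log n)^{3/2}+C_{\rm conf}\sqrt{\log(1/u)/n}$ (such constants exist by another theorem of the paper). For $n\ge n_{\rm SH}$, $\epsilon_2(n,u)=\min\{2M,\;C_{\rm rate}n^{-\beta/(2\beta+d)}(\log n)^{3/2}+C_{\rm conf}\sqrt{\log(1/u)/n}\}$, and $\epsilon_2(n,u)=2M$ for $n<n_{\rm SH}$. Weighted CQR. Sorting: $\hat f_{n,\alpha/2}=\widetilde f_{n,\alpha/2}\wedge\widetilde f_{n,1-\alpha/2}$, $\hat f_{n,1-\alpha/2}=\widetilde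 f_{n,\alpha/2}\vee\widetilde f_{n,1-\alpha/2}$. Score $\widehat S(x,y)=\max\{\hat f_{n,\alpha/2}(x)-y,\,y-\hat f_{n,1-\alpha/2}(x)\}$, $\widehat S_j=\widehat S(X_j,Y_j)$. For $x$ with $w(x)>0$ (full $Q_X$-measure), $\widehat Q^w_m(x)\in(-\infty,+\infty]$ is the $(1-\alpha)$-quantile (smallest $t$ with mass of $(-\infty,t]$ at least $1-\alpha$, $+\infty$ if no such real $t$) of $\sum_{j=1}^m\frac{w(X_j)}{\sum_iw(X_i)+w(x)}\delta_{\widehat S_j}+\frac{w(x)}{\sum_iw(X_i)+w(x)}\delta_{+\infty}$; $\hat{\mathcal C}^w_\alpha(x)=\{y\in\mathbb R:\widehat S(x,y)\le\widehat Q^w_m(x)\}$. Scales: $\eta^w_m(\delta)=9\sqrt{\frac{(1+\chi^2(Q_X\Vert P_X))\log(4/\delta)}m}+\frac{4w_{\max}\log(4/\delta)}{3m}$, $r_0=\alpha/(2\mu_{\rm up})$, $r_-=r_0\wedge\frac{1-\alpha}{2\mu_{\rm up}}$, $r_+=r_0$. *)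

theory Defs
  imports "HOL-Probability.Probability"
begin

definition cube :: "(real ^ 'd::finite) set" where
  "cube = cbox 0 1"

abbreviation cube_borel :: "(real ^ 'd::finite) measure" where
  "cube_borel \<equiv> restrict_space borel cube"

abbreviation obs_space :: "((real ^ 'd::finite) \<times> real) measure" where
  "obs_space \<equiv> cube_borel \<Otimes>\<^sub>M borel"

text \<open>The response has type \<^typ>\<open>real\<close>, so that the conditional law can be evaluated on prediction
  sets that are not contained in \<open>[-M, M]\<close>; boundedness says that it is concentrated there.\<close>

definition bounded_model ::
    "real \<Rightarrow> (real ^ 'd::finite) measure \<Rightarrow> (real ^ 'd \<Rightarrow> real measure) \<Rightarrow> bool" where
  "bounded_model M P \<kappa> \<longleftrightarrow>
     prob_space P \<and> sets P = sets cube_borel \<and>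
     \<kappa> \<in> cube_borel \<rightarrow>\<^sub>M prob_algebra borel \<and>
     (\<forall>x\<in>cube. measure (\<kappa> x) {-M..M} = 1)"

definition measure_support :: "real measure \<Rightarrow> real set" where
  "measure_support N = {y. \<forall>U. open U \<and> y \<in> U \<longrightarrow> emeasure N U > 0}"

definition density_condition ::
    "real \<Rightarrow> real \<Rightarrow> real \<Rightarrow> (real ^ 'd::finite \<Rightarrow> real measure) \<Rightarrow> bool" where
  "density_condition M \<mu>low \<mu>up \<kappa> \<longleftrightarrow>
     (\<forall>x\<in>cube. measure_support (\<kappa> x) = {-M..M} \<and>
       (\<exists>p. p \<in> borel_measurable borel \<and> (\<forall>y. 0 \<le> p y) \<and>
            \<kappa> x = density lborel (\<lambda>y. ennreal (p y)) \<and>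
            (\<forall>y\<in>{-M..M}. \<mu>low \<le> p y \<and> p y \<le> \<mu>up)))"

definition joint_law ::
    "(real ^ 'd::finite) measure \<Rightarrow> (real ^ 'd \<Rightarrow> real measure) \<Rightarrow> ((real ^ 'd) \<times> real) measure" where
  "joint_law P \<kappa> = P \<bind> (\<lambda>x. distr (\<kappa> x) obs_space (\<lambda>y. (x, y)))"

definition sample_law ::
    "nat \<Rightarrow> (real ^ 'd::finite) measure \<Rightarrow> (real ^ 'd \<Rightarrow> real measure) \<Rightarrow>
     (nat \<Rightarrow> (real ^ 'd) \<times> real) measure" where
  "sample_law n P \<kappa> = (\<Pi>\<^sub>M i\<in>{..<n}. joint_law P \<kappa>)"

definition cond_quantile :: "(real ^ 'd::finite \<Rightarrow> real measure) \<Rightarrow> real \<Rightarrow> real ^ 'd \<Rightarrow> real" where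
  "cond_quantile \<kappa> \<tau> x = Inf {t. measure (\<kappa> x) {..t} \<ge> \<tau>}"

definition oracle_interval ::
    "(real ^ 'd::finite \<Rightarrow> real measure) \<Rightarrow> real \<Rightarrow> real ^ 'd \<Rightarrow> real set" where
  "oracle_interval \<kappa> \<alpha> x = {cond_quantile \<kappa> (\<alpha>/2) x .. cond_quantile \<kappa> (1 - \<alpha>/2) x}"

definition coverage ::
    "(real ^ 'd::finite \<Rightarrow> real measure) \<Rightarrow> (real ^ 'd \<Rightarrow> real set) \<Rightarrow> real ^ 'd \<Rightarrow> real" where
  "coverage \<kappa> A x = measure (\<kappa> x) (A x)"

definition covariate_shift ::
    "(real ^ 'd::finite) measure \<Rightarrow> (real ^ 'd) measure \<Rightarrow> (real ^ 'd \<Rightarrow> real) \<Rightarrow> real \<Rightarrow> bool" where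
  "covariate_shift P Q w wmax \<longleftrightarrow>
     prob_space Q \<and> w \<in> borel_measurable P \<and> Q = density P (\<lambda>x. ennreal (w x)) \<and>
     (\<forall>x\<in>cube. 0 \<le> w x \<and> w x \<le> wmax)"

text \<open>The divergence \<open>\<chi>\<^sup>2(Q \<parallel> P)\<close>, as a function of \<open>P\<close> and \<open>w = dQ/dP\<close>.\<close>

definition chi2 :: "(real ^ 'd::finite) measure \<Rightarrow> (real ^ 'd \<Rightarrow> real) \<Rightarrow> real" where
  "chi2 P w = (\<integral>x. (w x - 1)\<^sup>2 \<partial>P)"

text \<open>The \<open>L\<^sup>2\<close> norm takes extended values, because a prediction set may have infinite length.\<close>

definition L2_enorm :: "'a measure \<Rightarrow> ('a \<Rightarrow> ereal) \<Rightarrow> ennreal" where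
  "L2_enorm N g =
     (let I = (\<integral>\<^sup>+ x. (e2ennreal \<bar>g x\<bar>)\<^sup>2 \<partial>N)
      in if I = \<top> then \<top> else ennreal (sqrt (enn2real I)))"

text \<open>Multi-indices are functions \<^typ>\<open>'d \<Rightarrow> nat\<close>.  \<open>D \<gamma>\<close> is the partial derivative of order \<open>\<gamma>\<close>
  of \<open>f\<close>; on the faces of the cube the derivatives are one-sided.  These conditions determine
  \<open>D \<gamma>\<close> on the cube for all \<open>\<gamma>\<close> of order at most \<open>k\<close>.\<close>

definition mi_order :: "('d::finite \<Rightarrow> nat) \<Rightarrow> nat" where
  "mi_order \<gamma> = (\<Sum>i\<in>UNIV. \<gamma> i)"

definition partial_derivatives ::
    "nat \<Rightarrow> (real ^ 'd::finite \<Rightarrow> real) \<Rightarrow> (('d \<Rightarrow> nat) \<Rightarrow> real ^ 'd \<Rightarrow> real) \<Rightarrow> bool" where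
  "partial_derivatives k f D \<longleftrightarrow>
     (\<forall>x\<in>cube. D (\<lambda>_. 0) x = f x) \<and>
     (\<forall>\<gamma> i. mi_order \<gamma> < k \<longrightarrow> (\<forall>x\<in>cube.
        ((\<lambda>t. D \<gamma> (x + t *\<^sub>R axis i 1)) has_real_derivative D (\<gamma>(i := Suc (\<gamma> i))) x)
          (at 0 within {t. x + t *\<^sub>R axis i 1 \<in> cube})))"

definition holder_ball :: "real \<Rightarrow> real \<Rightarrow> (real ^ 'd::finite \<Rightarrow> real) set" where
  "holder_ball \<beta> H = {f. \<exists>D.
     (let k = nat (\<lceil>\<beta>\<rceil> - 1) in
      partial_derivatives k f D \<and>
      (\<Sum>\<gamma> | mi_order \<gamma> \<le> k. SUP x\<in>cube. ereal \<bar>D \<gamma> x\<bar>) +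
      (\<Sum>\<gamma> | mi_order \<gamma> = k. SUP (x, y)\<in>{(x, y). x \<in> cube \<and> y \<in> cube \<and> x \<noteq> y}.
          ereal (\<bar>D \<gamma> x - D \<gamma> y\<bar> / infnorm (x - y) powr (\<beta> - real k)))
      \<le> ereal H)}"

definition smoothness ::
    "real \<Rightarrow> real \<Rightarrow> real \<Rightarrow> (real ^ 'd::finite \<Rightarrow> real measure) \<Rightarrow> bool" where
  "smoothness \<alpha> \<beta> H \<kappa> \<longleftrightarrow> (\<forall>\<tau>\<in>{\<alpha>/2, 1 - \<alpha>/2}. cond_quantile \<kappa> \<tau> \<in> holder_ball \<beta> H)"

definition relu :: "real \<Rightarrow> real" where
  "relu t = max t 0"

text \<open>\<open>W l i j\<close> is the entry in row \<open>i\<close> and column \<open>j\<close> of the matrix \<open>W\<^sub>l\<close>, and \<open>v l i\<close> is entry \<open>i\<close> of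
  the shift vector \<open>v\<^sub>l\<close>; entries are numbered from \<open>0\<close>, and only those below the widths \<open>p\<close> matter.\<close>

primrec hidden_layer ::
    "(nat \<Rightarrow> nat) \<Rightarrow> (nat \<Rightarrow> nat \<Rightarrow> nat \<Rightarrow> real) \<Rightarrow> (nat \<Rightarrow> nat \<Rightarrow> real) \<Rightarrow> (nat \<Rightarrow> real) \<Rightarrow>
     nat \<Rightarrow> nat \<Rightarrow> real" where
  "hidden_layer p W v x 0 = x"
| "hidden_layer p W v x (Suc l) =
     (\<lambda>i. relu ((\<Sum>j<p l. W l i j * hidden_layer p W v x l j) - v (Suc l) i))"

text \<open>The classes below do not depend on the numbering of the input coordinates, since the columns
  of \<open>W\<^sub>0\<close> can be permuted.\<close>

definition coord_numbering :: "nat \<Rightarrow> 'd::finite" where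
  "coord_numbering = (SOME e. bij_betw e {..<CARD('d)} (UNIV :: 'd set))"

definition relu_net ::
    "nat \<Rightarrow> (nat \<Rightarrow> nat) \<Rightarrow> (nat \<Rightarrow> nat \<Rightarrow> nat \<Rightarrow> real) \<Rightarrow> (nat \<Rightarrow> nat \<Rightarrow> real) \<Rightarrow>
     real ^ 'd::finite \<Rightarrow> real" where
  "relu_net L p W v x =
     (\<Sum>j<p L. W L 0 j * hidden_layer p W v (\<lambda>j. x $ coord_numbering j) L j)"

definition clip :: "real \<Rightarrow> real \<Rightarrow> real" where
  "clip M t = min (max t (- M)) M"

definition nonzero_entries ::
    "nat \<Rightarrow> (nat \<Rightarrow> nat) \<Rightarrow> (nat \<Rightarrow> nat \<Rightarrow> nat \<Rightarrow> real) \<Rightarrow> (nat \<Rightarrow> nat \<Rightarrow> real) \<Rightarrow> nat" where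
  "nonzero_entries L p W v =
     (\<Sum>l=0..L. card {(i, j). i < p (Suc l) \<and> j < p l \<and> W l i j \<noteq> 0}) +
     (\<Sum>l=1..L. card {i. i < p l \<and> v l i \<noteq> 0})"

definition sparse_class ::
    "nat \<Rightarrow> (nat \<Rightarrow> nat) \<Rightarrow> nat \<Rightarrow> real \<Rightarrow> (real ^ 'd::finite \<Rightarrow> real) set" where
  "sparse_class L p s M = {\<lambda>x. clip M (relu_net L p W v x) | W v.
     (\<forall>l\<le>L. \<forall>i<p (Suc l). \<forall>j<p l. \<bar>W l i j\<bar> \<le> 1) \<and>
     (\<forall>l\<in>{1..L}. \<forall>i<p l. \<bar>v l i\<bar> \<le> 1) \<and>
     nonzero_entries L p W v \<le> s}"

definition N_SH :: "nat \<Rightarrow> real \<Rightarrow> nat \<Rightarrow> nat" where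
  "N_SH d \<beta> n = nat \<lceil>real n powr (real d / (2 * \<beta> + real d))\<rceil>"

definition L_SH :: "nat \<Rightarrow> real \<Rightarrow> nat \<Rightarrow> nat" where
  "L_SH d \<beta> n = nat (8 + (\<lceil>log 2 (real n)\<rceil> + 5) * (1 + \<lceil>log 2 (max (real d) \<beta>)\<rceil>))"

definition W_SH :: "nat \<Rightarrow> real \<Rightarrow> nat \<Rightarrow> nat" where
  "W_SH d \<beta> n = 6 * (d + nat \<lceil>\<beta>\<rceil>) * N_SH d \<beta> n"

definition p_SH :: "nat \<Rightarrow> real \<Rightarrow> nat \<Rightarrow> nat \<Rightarrow> nat" where
  "p_SH d \<beta> n l = (if l = 0 then d else if l \<le> L_SH d \<beta> n then W_SH d \<beta> n else 1)"

definition S_SH :: "nat \<Rightarrow> real \<Rightarrow> nat \<Rightarrow> nat" where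
  "S_SH d \<beta> n = nat \<lceil>141 * (real d + \<beta> + 1) ^ (3 + d) * real (N_SH d \<beta> n)
                       * (of_int \<lceil>log 2 (real n)\<rceil> + 6)\<rceil>"

definition n_SH :: "nat \<Rightarrow> real \<Rightarrow> real \<Rightarrow> nat" where
  "n_SH d \<beta> H = nat \<lceil>
     max ((\<beta> + 1) powr (2 * \<beta> + real d))
     (max ((H + 1) powr ((2 * \<beta> + real d) / real d) * exp (2 * \<beta> + real d))
          (exp (3 * (2 * \<beta> + real d) / (2 * \<beta>))))\<rceil>"

definition F_SH :: "real \<Rightarrow> real \<Rightarrow> nat \<Rightarrow> (real ^ 'd::finite \<Rightarrow> real) set" where
  "F_SH \<beta> M n = sparse_class (L_SH CARD('d) \<beta> n) (p_SH CARD('d) \<beta> n) (S_SH CARD('d) \<beta> n) M"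

definition pinball :: "real \<Rightarrow> real \<Rightarrow> real" where
  "pinball \<tau> u = u * (\<tau> - (if u < 0 then 1 else 0))"

definition empirical_risk ::
    "real \<Rightarrow> nat \<Rightarrow> (nat \<Rightarrow> (real ^ 'd::finite) \<times> real) \<Rightarrow> (real ^ 'd \<Rightarrow> real) \<Rightarrow> real" where
  "empirical_risk \<tau> n D f = (\<Sum>i<n. pinball \<tau> (snd (D i) - f (fst (D i)))) / real n"

text \<open>Minimality is only demanded for data in \<open>([0,1]\<^sup>d \<times> [-M,M])\<^sup>n\<close>, a set of full measure.\<close>

definition measurable_erm ::
    "real \<Rightarrow> real \<Rightarrow> real \<Rightarrow> nat \<Rightarrow>
     ((nat \<Rightarrow> (real ^ 'd::finite) \<times> real) \<Rightarrow> real ^ 'd \<Rightarrow> real) \<Rightarrow> bool" where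
  "measurable_erm \<beta> M \<tau> n f \<longleftrightarrow>
     (\<lambda>(D, x). f D x) \<in> borel_measurable ((\<Pi>\<^sub>M i\<in>{..<n}. obs_space) \<Otimes>\<^sub>M cube_borel) \<and>
     (\<forall>D \<in> (\<Pi>\<^sub>E i\<in>{..<n}. cube \<times> {-M..M}).
        f D \<in> F_SH \<beta> M n \<and> (\<forall>g\<in>F_SH \<beta> M n. empirical_risk \<tau> n D (f D) \<le> empirical_risk \<tau> n D g))"

definition endpoint_rate :: "nat \<Rightarrow> real \<Rightarrow> real \<Rightarrow> real \<Rightarrow> nat \<Rightarrow> real \<Rightarrow> real" where
  "endpoint_rate d \<beta> Crate Cconf n u =
     Crate * real n powr (- \<beta> / (2 * \<beta> + real d)) * ln (real n) powr (3/2)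
     + Cconf * sqrt (ln (1/u) / real n)"

text \<open>The argument of type \<^typ>\<open>'d itself\<close> only carries the dimension.\<close>

definition endpoint_constants ::
    "'d::finite itself \<Rightarrow> real \<Rightarrow> real \<Rightarrow> real \<Rightarrow> real \<Rightarrow> real \<Rightarrow> real \<Rightarrow> real \<Rightarrow> real \<Rightarrow> bool" where
  "endpoint_constants _ \<alpha> \<mu>low \<mu>up \<beta> M H Crate Cconf \<longleftrightarrow>
     0 < Crate \<and> 0 < Cconf \<and>
     (\<forall>(P :: (real ^ 'd) measure) \<kappa>.
        bounded_model M P \<kappa> \<and> density_condition M \<mu>low \<mu>up \<kappa> \<and> smoothness \<alpha> \<beta> H \<kappa> \<longrightarrow>
        (\<forall>\<tau>\<in>{\<alpha>/2, 1 - \<alpha>/2}. \<forall>u n f.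
           0 < u \<and> u < 1 \<and> n \<ge> n_SH CARD('d) \<beta> H \<and> measurable_erm \<beta> M \<tau> n f \<longrightarrow>
           measure (sample_law n P \<kappa>)
             {D \<in> space (sample_law n P \<kappa>).
                L2_enorm P (\<lambda>x. ereal (f D x - cond_quantile \<kappa> \<tau> x))
                  \<le> ennreal (endpoint_rate CARD('d) \<beta> Crate Cconf n u)}
           \<ge> 1 - u))"

definition eps2 :: "nat \<Rightarrow> real \<Rightarrow> real \<Rightarrow> real \<Rightarrow> real \<Rightarrow> real \<Rightarrow> nat \<Rightarrow> real \<Rightarrow> real" where
  "eps2 d \<beta> M H Crate Cconf n u =
     (if n \<ge> n_SH d \<beta> H then min (2 * M) (endpoint_rate d \<beta> Crate Cconf n u) else 2 * M)"

definition cqr_score :: "(real ^ 'd::finite \<Rightarrow> real) \<Rightarrow> (real ^ 'd \<Rightarrow> real) \<Rightarrow> real ^ 'd \<Rightarrow> real \<Rightarrow> real" where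
  "cqr_score lo hi x y = max (lo x - y) (y - hi x)"

text \<open>The mass that the weighted score distribution at \<open>x\<close> gives to \<open>(-\<infinity>, t]\<close> for real \<open>t\<close>; its atom
  at \<open>+\<infinity>\<close>, of weight \<open>w x / ((\<Sum>i<m. w (X\<^sub>i)) + w x)\<close>, does not contribute.\<close>

definition weighted_score_mass ::
    "(real ^ 'd::finite \<Rightarrow> real) \<Rightarrow> (real ^ 'd \<Rightarrow> real \<Rightarrow> real) \<Rightarrow> nat \<Rightarrow>
     (nat \<Rightarrow> (real ^ 'd) \<times> real) \<Rightarrow> real ^ 'd \<Rightarrow> real \<Rightarrow> real" where
  "weighted_score_mass w S m D x t =
     (\<Sum>j<m. w (fst (D j)) / ((\<Sum>i<m. w (fst (D i))) + w x)
            * indicator {..t} (S (fst (D j)) (snd (D j))))"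

text \<open>\<open>Inf {} = \<infinity>\<close> in \<^typ>\<open>ereal\<close>.\<close>

definition weighted_quantile ::
    "real \<Rightarrow> (real ^ 'd::finite \<Rightarrow> real) \<Rightarrow> (real ^ 'd \<Rightarrow> real \<Rightarrow> real) \<Rightarrow> nat \<Rightarrow>
     (nat \<Rightarrow> (real ^ 'd) \<times> real) \<Rightarrow> real ^ 'd \<Rightarrow> ereal" where
  "weighted_quantile \<alpha> w S m D x = Inf (ereal ` {t. weighted_score_mass w S m D x t \<ge> 1 - \<alpha>})"

definition weighted_cqr ::
    "real \<Rightarrow> (real ^ 'd::finite \<Rightarrow> real) \<Rightarrow> (real ^ 'd \<Rightarrow> real) \<Rightarrow> (real ^ 'd \<Rightarrow> real) \<Rightarrow> nat \<Rightarrow>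
     (nat \<Rightarrow> (real ^ 'd) \<times> real) \<Rightarrow> real ^ 'd \<Rightarrow> real set" where
  "weighted_cqr \<alpha> w f1 f2 m D x =
     (let S = cqr_score (\<lambda>x. min (f1 x) (f2 x)) (\<lambda>x. max (f1 x) (f2 x))
      in {y. ereal (S x y) \<le> weighted_quantile \<alpha> w S m D x})"

definition eta_w :: "(real ^ 'd::finite) measure \<Rightarrow> (real ^ 'd \<Rightarrow> real) \<Rightarrow> real \<Rightarrow> nat \<Rightarrow> real \<Rightarrow> real" where
  "eta_w P w wmax m \<delta> =
     9 * sqrt ((1 + chi2 P w) * ln (4/\<delta>) / real m) + 4 * wmax * ln (4/\<delta>) / (3 * real m)"

definition r_zero :: "real \<Rightarrow> real \<Rightarrow> real" where
  "r_zero \<alpha> \<mu>up = \<alpha> / (2 * \<mu>up)"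

definition r_minus :: "real \<Rightarrow> real \<Rightarrow> real" where
  "r_minus \<alpha> \<mu>up = min (r_zero \<alpha> \<mu>up) ((1 - \<alpha>) / (2 * \<mu>up))"

definition r_plus :: "real \<Rightarrow> real \<Rightarrow> real" where
  "r_plus \<alpha> \<mu>up = r_zero \<alpha> \<mu>up"

definition length_error ::
    "(real ^ 'd::finite) measure \<Rightarrow> (real ^ 'd \<Rightarrow> real set) \<Rightarrow> (real ^ 'd \<Rightarrow> real set) \<Rightarrow> ennreal" where
  "length_error Q A B =
     L2_enorm Q (\<lambda>x. \<bar>enn2ereal (emeasure lborel (A x)) - enn2ereal (emeasure lborel (B x))\<bar>)"

definition coverage_error ::
    "(real ^ 'd::finite) measure \<Rightarrow> (real ^ 'd \<Rightarrow> real measure) \<Rightarrow> real \<Rightarrow>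
     (real ^ 'd \<Rightarrow> real set) \<Rightarrow> ennreal" where
  "coverage_error Q \<kappa> \<alpha> A = L2_enorm Q (\<lambda>x. ereal (coverage \<kappa> A x - (1 - \<alpha>)))"

end

theory Submission
  imports Defs
begin

text \<open>
  Write \<open>S\<close> for the fitted score, \<open>w\<close> for the likelihood ratio \<open>dQ/dP\<close>, \<open>V = 1 + \<chi>\<^sup>2 = E w\<^sup>2\<close>, \<open>\<eta>\<close> for
  \<open>eta_w\<close>, and \<open>\<epsilon>\<close> for the L2(P) error of the two raw endpoints.  Both errors of the prediction set at
  \<open>x\<close> are at most a constant times \<open>D(x) + 2 \<bar>q(x)\<bar>\<close>, where \<open>D\<close> is the sum of the absolute endpoint
  errors and \<open>q(x)\<close> is the weighted quantile: sorting does not increase \<open>D\<close>, and the conditional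
  distribution functions are Lipschitz.  Since \<open>w \<le> w\<^sub>m\<^sub>a\<^sub>x\<close>, the norm of \<open>D\<close> in L2(Q) is at most
  \<open>2 sqrt w\<^sub>m\<^sub>a\<^sub>x \<epsilon>\<close>, so everything rests on a bound for \<open>\<bar>q(x)\<bar>\<close>.

  The oracle interval has conditional coverage exactly \<open>1 - \<alpha>\<close>.  Widening it by a small \<open>t\<close> on both
  sides gains at least \<open>2 \<mu>\<^sub>l\<^sub>o\<^sub>w t\<close>, narrowing it loses as much, and replacing its endpoints by the fitted
  ones changes the \<open>Q\<close>-average by at most a bias \<open>A = 2 \<mu>\<^sub>u\<^sub>p sqrt w\<^sub>m\<^sub>a\<^sub>x \<epsilon>\<close> (\<open>mean_excess_widened\<close>,
  \<open>mean_excess_narrowed\<close>).  In terms of the variables \<open>w(X) (1{S(X,Y) \<le> t} - (1 - \<alpha>))\<close>, the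
  condition \<open>q(x) \<le> t\<close> says that their sum over the calibration sample is at least \<open>(1 - \<alpha>) w(x)\<close>.

  The level \<open>(1 - \<alpha>) w(x)\<close> varies with \<open>x\<close>, so the sums have to be controlled at all scales at once,
  yet without the logarithmic loss of a union bound over a fine grid.  The geometric grid
  \<open>t\<^sub>k = 2\<^sup>k t\<^sub>0\<close> with \<open>t\<^sub>0\<close> proportional to \<open>A + 3 \<eta>\<close> suffices: at \<open>t\<^sub>k\<close> the mean exceeds what is needed
  by a multiple of \<open>2\<^sup>k \<eta>\<close>, so a deviation of that size is permitted there, and its probability
  \<open>(\<delta>/4)\<close> to the power \<open>2 2\<^sup>k\<close> is summable in \<open>k\<close> (\<open>excess_sum_tail\<close>, \<open>typical_calibration_prob\<close>).  A
  Bernstein bound at single points (\<open>iid_sum_upper_tail\<close>) is therefore all the concentration required.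
  The first grid point above the level of \<open>x\<close> gives, up to a constant factor,
  \<open>\<bar>q(x)\<bar> \<le> t\<^sub>0 + w(x) / m\<close> (\<open>weighted_quantile_eq_real\<close>); where the grid leaves the
  range in which the density bounds act, the right hand side is bounded below and the trivial bound
  \<open>\<bar>q(x)\<bar> \<le> 2 M\<close> takes over.  That trivial bound needs \<open>q(x) < \<infinity>\<close>, which follows from the second size
  condition and a lower tail bound for the sum of the weights.

  Finally, the L2(Q) norm of \<open>w / m\<close> is at most \<open>sqrt (w\<^sub>m\<^sub>a\<^sub>x V) / m\<close>, because
  \<open>\<integral> w\<^sup>2 dQ = \<integral> w\<^sup>3 dP\<close>.  The training bounds fail with probability at most \<open>\<delta>/2\<close>, and for each
  successful training sample the calibration event fails with probability at most \<open>\<delta>/2\<close>; Fubini combines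
  them once the errors are known to be measurable functions of the data.
\<close>

section \<open>An exponential tail bound for sums of independent copies\<close>

lemma exp_le_quadratic:
  fixes y :: real
  assumes "y \<le> 1"
  shows "exp y \<le> 1 + y + y\<^sup>2"
proof (cases "0 \<le> y")
  case True
  then show ?thesis using assms by (rule exp_bound)
next
  case False
  have "1 \<le> (1 - y) * (1 + y + y\<^sup>2)"
  proof -
    have "(1 - y) * (1 + y + y\<^sup>2) = 1 + (-y) ^ 3" by (simp add: algebra_simps power2_eq_square power3_eq_cube)
    then show ?thesis using False by simp
  qed
  also have "\<dots> \<le> exp (-y) * (1 + y + y\<^sup>2)"
  proof (rule mult_right_mono)
    show "1 - y \<le> exp (-y)" using exp_ge_add_one_self[of "-y"] by simp
    have "0 \<le> (1 + 2 * y)\<^sup>2 + 3" by simp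
    then show "0 \<le> 1 + y + y\<^sup>2" by (simp add: power2_eq_square algebra_simps)
  qed
  finally show ?thesis by (simp add: exp_minus field_simps)
qed

text \<open>
  Chernoff's method with the quadratic bound for the exponential, a form of Bernstein's inequality.
  Only an upper bound on the variables enters the range condition; in particular, for nonpositive
  variables \<open>b\<close> can be chosen freely, and the tail is then Gaussian at every scale.
\<close>
lemma iid_sum_upper_tail:
  fixes N :: "'a measure" and Z :: "'a \<Rightarrow> real" and b V \<mu> s L :: real and m :: nat
  assumes N: "prob_space N" and Z: "integrable N Z" "integrable N (\<lambda>x. (Z x)\<^sup>2)"
    and le: "\<And>x. x \<in> space N \<Longrightarrow> Z x \<le> b"
    and var: "(\<integral>x. (Z x)\<^sup>2 \<partial>N) \<le> V" and mean: "(\<integral>x. Z x \<partial>N) \<le> \<mu>"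
    and pos: "0 < b" "0 < V" "0 < s"
    and L: "4 * V * L \<le> m * s\<^sup>2" "2 * b * L \<le> m * s"
  shows "measure (\<Pi>\<^sub>M i\<in>{..<m}. N)
           {\<omega> \<in> space (\<Pi>\<^sub>M i\<in>{..<m}. N). real m * (\<mu> + s) \<le> (\<Sum>i<m. Z (\<omega> i))} \<le> exp (- L)"
proof -
  interpret N: prob_space N by fact
  interpret PS: product_prob_space "\<lambda>_. N" "{..<m}" by unfold_locales
  let ?\<Pi> = "\<Pi>\<^sub>M i\<in>{..<m}. N"
  have Zm [measurable]: "Z \<in> borel_measurable N" using Z(1) by auto
  \<comment> \<open>\<open>s / (2 V)\<close> minimises the exponent \<open>- l s + l\<^sup>2 V\<close>; the cap \<open>1 / b\<close> keeps \<open>l Z \<le> 1\<close>, the range in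
    which the quadratic bound holds.\<close>
  define l where "l = min (1 / b) (s / (2 * V))"
  have l: "0 < l" "l * b \<le> 1" "l * V \<le> s / 2"
    using pos by (auto simp: l_def min_def field_simps)
  have exp1: "(\<integral>\<^sup>+ x. ennreal (exp (l * Z x)) \<partial>N) \<le> ennreal (exp (l * \<mu> + l\<^sup>2 * V))"
  proof -
    have quad: "exp (l * Z x) \<le> 1 + l * Z x + l\<^sup>2 * (Z x)\<^sup>2" if "x \<in> space N" for x
    proof -
      have "l * Z x \<le> 1"
        using mult_left_mono[OF le[OF that], of l] l by linarith
      from exp_le_quadratic[OF this] show ?thesis by (simp add: power_mult_distrib)
    qed
    have "(\<integral>\<^sup>+ x. ennreal (exp (l * Z x)) \<partial>N) \<le> (\<integral>\<^sup>+ x. ennreal (1 + l * Z x + l\<^sup>2 * (Z x)\<^sup>2) \<partial>N)"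
      by (intro nn_integral_mono ennreal_leI quad)
    also have "\<dots> = ennreal (\<integral>x. 1 + l * Z x + l\<^sup>2 * (Z x)\<^sup>2 \<partial>N)"
    proof (rule nn_integral_eq_integral)
      show "integrable N (\<lambda>x. 1 + l * Z x + l\<^sup>2 * (Z x)\<^sup>2)" using Z by auto
      show "AE x in N. 0 \<le> 1 + l * Z x + l\<^sup>2 * (Z x)\<^sup>2"
        by (rule AE_I2) (meson quad exp_ge_zero order_trans)
    qed
    also have "(\<integral>x. 1 + l * Z x + l\<^sup>2 * (Z x)\<^sup>2 \<partial>N) = 1 + l * (\<integral>x. Z x \<partial>N) + l\<^sup>2 * (\<integral>x. (Z x)\<^sup>2 \<partial>N)"
      using Z by (simp add: N.prob_space)
    also have "\<dots> \<le> 1 + (l * \<mu> + l\<^sup>2 * V)"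
      using mean var l by (simp add: add_mono mult_left_mono)
    also have "\<dots> \<le> exp (l * \<mu> + l\<^sup>2 * V)" by (rule exp_ge_add_one_self)
    finally show ?thesis by (simp add: ennreal_leI)
  qed
  have "emeasure ?\<Pi> {\<omega> \<in> space ?\<Pi>. real m * (\<mu> + s) \<le> (\<Sum>i<m. Z (\<omega> i))}
      \<le> ennreal (exp (- l * (real m * (\<mu> + s)))) *
        (\<integral>\<^sup>+ \<omega>. ennreal (exp (l * (\<Sum>i<m. Z (\<omega> i)))) * indicator (space ?\<Pi>) \<omega> \<partial>?\<Pi>)"
    using l(1) by (rule Chernoff_ineq_nn_integral_ge) auto
  also have "(\<integral>\<^sup>+ \<omega>. ennreal (exp (l * (\<Sum>i<m. Z (\<omega> i)))) * indicator (space ?\<Pi>) \<omega> \<partial>?\<Pi>)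
      = (\<integral>\<^sup>+ \<omega>. (\<Prod>i<m. ennreal (exp (l * Z (\<omega> i)))) \<partial>?\<Pi>)"
    by (rule nn_integral_cong) (simp add: prod_ennreal exp_sum sum_distrib_left)
  also have "\<dots> = (\<Prod>i<m. (\<integral>\<^sup>+ x. ennreal (exp (l * Z x)) \<partial>N))"
    by (rule PS.product_nn_integral_prod) auto
  also have "\<dots> \<le> (\<Prod>i<m. ennreal (exp (l * \<mu> + l\<^sup>2 * V)))"
    by (simp add: power_mono_ennreal exp1)
  also have "\<dots> = ennreal (exp (real m * (l * \<mu> + l\<^sup>2 * V)))"
    by (simp add: ennreal_power exp_of_nat_mult)
  also have "ennreal (exp (- l * (real m * (\<mu> + s)))) * ennreal (exp (real m * (l * \<mu> + l\<^sup>2 * V)))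
      = ennreal (exp (real m * l * (l * V - s)))"
    by (simp add: ennreal_mult[symmetric] exp_add[symmetric] algebra_simps power2_eq_square)
  also have "\<dots> \<le> ennreal (exp (- L))"
  proof (rule ennreal_leI, subst exp_le_cancel_iff)
    have "L \<le> real m * s / 2 * l"
      using L pos by (auto simp: l_def min_def field_simps power2_eq_square)
    moreover have "real m * l * (l * V - s) \<le> real m * l * (s / 2 - s)"
      using l by (intro mult_left_mono) auto
    ultimately show "real m * l * (l * V - s) \<le> - L" by (simp add: algebra_simps)
  qed
  finally show ?thesis
    by (simp add: measure_def enn2real_leI mult_left_mono)
qed

section \<open>Laws with density bounded from both sides\<close>

locale two_sided_density =
  fixes N :: "real measure" and p :: "real \<Rightarrow> real" and lo up M :: real
  assumes prob: "prob_space N" and p_meas [measurable]: "p \<in> borel_measurable borel"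
    and N_eq: "N = density lborel (\<lambda>y. ennreal (p y))"
    and p_bounds: "\<And>y. y \<in> {-M..M} \<Longrightarrow> lo \<le> p y \<and> p y \<le> up"
    and carrier: "measure N {-M..M} = 1"
    and lo_pos: "0 < lo" and M_pos: "0 < M"
begin

sublocale real_distribution N
  using prob by (intro real_distribution.intro) (auto simp: N_eq real_distribution_axioms_def)

lemma lo_le_up: "lo \<le> up"
  using p_bounds[of 0] M_pos by auto

lemma up_pos: "0 < up"
  using lo_le_up lo_pos by linarith

lemma AE_in_carrier: "AE y in N. y \<in> {-M..M}"
  using carrier by (intro AE_prob_1) auto

lemma prob_singleton: "measure N {c} = 0"
proof -
  have "emeasure N {c} = (\<integral>\<^sup>+ y. ennreal (p y) * indicator {c} y \<partial>lborel)"
    by (simp add: N_eq emeasure_density)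
  also have "\<dots> = 0"
    by (rule nn_integral_null_set) auto
  finally show ?thesis by (simp add: measure_def)
qed

lemma cdf_below: "a \<le> -M \<Longrightarrow> cdf N a = 0"
proof -
  assume a: "a \<le> -M"
  have ne: "AE y in N. y \<noteq> -M"
    using prob_singleton[of "-M"] by (intro AE_I[where N = "{-M}"]) (auto simp: emeasure_eq_measure)
  have "AE y in N. y \<notin> {..a}"
    using AE_in_carrier ne by eventually_elim (use a in auto)
  then show ?thesis by (subst cdf_def, subst prob_eq_0) auto
qed

lemma cdf_above: "M \<le> b \<Longrightarrow> cdf N b = 1"
proof -
  assume b: "M \<le> b"
  have "AE y in N. y \<in> {..b}"
    using AE_in_carrier by eventually_elim (use b in auto)
  then show ?thesis by (subst cdf_def, subst prob_eq_1) auto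
qed

lemma cdf_increment_bounds:
  assumes "-M \<le> a" "a \<le> b" "b \<le> M"
  shows "lo * (b - a) \<le> cdf N b - cdf N a" "cdf N b - cdf N a \<le> up * (b - a)"
proof -
  have eq: "cdf N b - cdf N a = measure N {a<..b}"
    using assms by (cases "a = b") (auto simp: cdf_diff_eq)
  have em: "emeasure N {a<..b} = (\<integral>\<^sup>+ y. ennreal (p y) * indicator {a<..b} y \<partial>lborel)"
    by (simp add: N_eq emeasure_density)
  have "ennreal (lo * (b - a)) = (\<integral>\<^sup>+ y. ennreal lo * indicator {a<..b} y \<partial>lborel)"
    using assms lo_pos by (simp add: nn_integral_cmult_indicator ennreal_mult)
  also have "\<dots> \<le> emeasure N {a<..b}"
    unfolding em using assms p_bounds
    by (intro nn_integral_mono) (auto simp: indicator_def intro!: ennreal_leI)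
  finally show "lo * (b - a) \<le> cdf N b - cdf N a"
    by (simp add: eq emeasure_eq_measure)
  have "emeasure N {a<..b} \<le> (\<integral>\<^sup>+ y. ennreal up * indicator {a<..b} y \<partial>lborel)"
    unfolding em using assms p_bounds
    by (intro nn_integral_mono) (auto simp: indicator_def intro!: ennreal_leI)
  also have "\<dots> = ennreal (up * (b - a))"
    using assms up_pos by (simp add: nn_integral_cmult_indicator ennreal_mult)
  finally show "cdf N b - cdf N a \<le> up * (b - a)"
    using assms up_pos by (simp add: eq emeasure_eq_measure)
qed

text \<open>
  The distribution function is constant outside the carrier, so estimates on \<open>[-M, M]\<close> extend to the
  whole line by clipping the arguments.
\<close>
lemma cdf_clip: "cdf N t = cdf N (max (-M) (min M t))"
  using cdf_below[of t] cdf_below[of "-M"] cdf_above[of t] cdf_above[of M] M_pos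
  by (auto simp: max_def min_def)

lemma cdf_lipschitz: "\<bar>cdf N a - cdf N b\<bar> \<le> up * \<bar>a - b\<bar>"
proof -
  have *: "\<bar>cdf N a - cdf N b\<bar> \<le> up * (b - a)" if "a \<le> b" for a b
  proof -
    let ?a = "max (-M) (min M a)" and ?b = "max (-M) (min M b)"
    have "cdf N b - cdf N a \<le> up * (?b - ?a)"
      using cdf_increment_bounds(2)[of ?a ?b] that M_pos cdf_clip[of a] cdf_clip[of b] by auto
    also have "\<dots> \<le> up * (b - a)"
      using that up_pos M_pos by (intro mult_left_mono) auto
    finally show ?thesis using cdf_nondecreasing[OF that] by simp
  qed
  show ?thesis using *[of a b] *[of b a] by (cases "a \<le> b") auto
qed

text \<open>
  The formula covers crossed endpoints \<open>b < a\<close>, which occur when an interval is narrowed too far.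
\<close>
lemma prob_atLeastAtMost: "measure N {a..b} = max 0 (cdf N b - cdf N a)"
proof (cases "a \<le> b")
  case True
  have "measure N {a..b} = measure N ({a} \<union> {a<..b})"
    using True by (intro arg_cong[where f = "measure N"]) auto
  also have "\<dots> = measure N {a<..b}"
    by (subst finite_measure_Union) (auto simp: prob_singleton)
  also have "\<dots> = cdf N b - cdf N a"
    using True by (cases "a = b") (auto simp: cdf_diff_eq)
  finally show ?thesis using cdf_nondecreasing[OF True] by simp
next
  case False
  then show ?thesis using cdf_nondecreasing[of b a] by (simp add: max_def)
qed

lemma cdf_quantile:
  assumes "0 < \<tau>" "\<tau> < 1"
  defines "q \<equiv> Inf {t. \<tau> \<le> cdf N t}"
  shows "cdf N q = \<tau>" "q \<in> {-M..M}"
proof -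
  have "\<exists>x\<ge>-M. x \<le> M \<and> cdf N x = \<tau>"
    using assms M_pos by (intro IVT) (auto simp: cdf_below cdf_above isCont_cdf prob_singleton)
  then obtain x where x: "-M \<le> x" "x \<le> M" "cdf N x = \<tau>" by auto
  have "q = x" unfolding q_def
  proof (rule cInf_eq_minimum)
    show "x \<in> {t. \<tau> \<le> cdf N t}" using x by simp
    fix t assume t: "t \<in> {t. \<tau> \<le> cdf N t}"
    show "x \<le> t"
    proof (rule ccontr)
      assume "\<not> x \<le> t"
      then have tx: "t < x" by simp
      have "-M < t" using t cdf_below[of t] assms(1) by (cases "-M < t") auto
      then have "lo * (x - t) \<le> cdf N x - cdf N t"
        using tx x by (intro cdf_increment_bounds) auto
      moreover have "0 < lo * (x - t)" using tx lo_pos by simp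
      ultimately show False using x t by simp
    qed
  qed
  then show "cdf N q = \<tau>" "q \<in> {-M..M}" using x by auto
qed

text \<open>
  The Galois connection between quantile and distribution function, from which measurability of the
  conditional quantiles is read off.
\<close>
lemma quantile_le_iff:
  assumes "0 < \<tau>" "\<tau> < 1"
  shows "Inf {t. \<tau> \<le> cdf N t} \<le> a \<longleftrightarrow> \<tau> \<le> cdf N a"
proof
  assume "Inf {t. \<tau> \<le> cdf N t} \<le> a"
  then show "\<tau> \<le> cdf N a" using cdf_nondecreasing cdf_quantile(1)[OF assms] by metis
next
  assume a: "\<tau> \<le> cdf N a"
  have "bdd_below {t. \<tau> \<le> cdf N t}"
  proof (rule bdd_belowI)
    fix t assume "t \<in> {t. \<tau> \<le> cdf N t}"
    then show "-M \<le> t" using cdf_below[of t] assms by (cases "-M \<le> t") auto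
  qed
  then show "Inf {t. \<tau> \<le> cdf N t} \<le> a" using a by (intro cInf_lower) auto
qed

end

locale two_sided_density_level = two_sided_density +
  fixes \<alpha> q1 q2 :: real
  assumes \<alpha>: "0 < \<alpha>" "\<alpha> < 1"
    and q1: "q1 = Inf {t. \<alpha> / 2 \<le> cdf N t}"
    and q2: "q2 = Inf {t. 1 - \<alpha> / 2 \<le> cdf N t}"
begin

lemma cdf_q1: "cdf N q1 = \<alpha> / 2" "q1 \<in> {-M..M}"
  and cdf_q2: "cdf N q2 = 1 - \<alpha> / 2" "q2 \<in> {-M..M}"
  using cdf_quantile[of "\<alpha> / 2"] cdf_quantile[of "1 - \<alpha> / 2"] \<alpha> by (auto simp: q1 q2)

lemma q1_le_q2: "q1 \<le> q2"
  using cdf_nondecreasing[of q2 q1] cdf_q1 cdf_q2 \<alpha> by (cases "q1 \<le> q2") auto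

text \<open>
  An \<open>up\<close>-Lipschitz distribution function cannot gain mass quickly, so each quantile keeps a distance
  from the ends of the carrier, and the lower density bound acts on both sides of it.
\<close>
lemma margins:
  assumes "t \<le> min \<alpha> (1 - \<alpha>) / (2 * up)"
  shows "q2 + t \<le> M" "-M \<le> q1 - t" "q1 + t \<le> M" "-M \<le> q2 - t"
proof -
  have t: "up * t \<le> min \<alpha> (1 - \<alpha>) / 2" using assms up_pos by (simp add: field_simps)
  have *: "t \<le> b" if "\<alpha> / 2 \<le> up * b \<or> 1 - \<alpha> / 2 \<le> up * b" for b
  proof -
    have "2 * (up * t) \<le> \<alpha>" "2 * (up * t) \<le> 1 - \<alpha>" using t by auto
    then have "up * t \<le> \<alpha> / 2" "up * t \<le> 1 - \<alpha> / 2" using \<alpha> by auto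
    then have "up * t \<le> up * b" using that by auto
    then show ?thesis using up_pos by simp
  qed
  have "cdf N M = 1" "cdf N (-M) = 0" using cdf_above cdf_below by auto
  then show "q2 + t \<le> M" "-M \<le> q1 - t" "q1 + t \<le> M" "-M \<le> q2 - t"
    using *[of "M - q2"] *[of "q1 + M"] *[of "M - q1"] *[of "q2 + M"]
      cdf_increment_bounds(2)[of q2 M] cdf_increment_bounds(2)[of "-M" q1]
      cdf_increment_bounds(2)[of q1 M] cdf_increment_bounds(2)[of "-M" q2] cdf_q1 cdf_q2 \<alpha>
    by auto
qed

text \<open>
  Each endpoint moved outwards by \<open>t\<close> gains at least \<open>lo t\<close>; an error in its position costs at most
  \<open>up\<close> times that error.
\<close>
lemma prob_widened:
  assumes "0 \<le> t" "t \<le> min \<alpha> (1 - \<alpha>) / (2 * up)"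
  shows "1 - \<alpha> + 2 * lo * t - up * (\<bar>l - q1\<bar> + \<bar>h - q2\<bar>) \<le> measure N {l - t..h + t}"
proof -
  have "cdf N (q2 + t) - up * \<bar>h - q2\<bar> \<le> cdf N (h + t)"
    using cdf_lipschitz[of "q2 + t" "h + t"] by (simp add: abs_minus_commute)
  moreover have "cdf N (l - t) \<le> cdf N (q1 - t) + up * \<bar>l - q1\<bar>"
    using cdf_lipschitz[of "l - t" "q1 - t"] by simp
  moreover have "lo * t \<le> cdf N (q2 + t) - cdf N q2" "lo * t \<le> cdf N q1 - cdf N (q1 - t)"
    using cdf_increment_bounds(1)[of q2 "q2 + t"] cdf_increment_bounds(1)[of "q1 - t" q1]
      margins[OF assms(2)] assms(1) cdf_q1(2) cdf_q2(2) by auto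
  ultimately show ?thesis
    unfolding prob_atLeastAtMost using cdf_q1(1) cdf_q2(1) by (simp add: algebra_simps)
qed

lemma prob_narrowed:
  assumes "0 \<le> t" "t \<le> min \<alpha> (1 - \<alpha>) / (2 * up)"
  shows "measure N {l + t..h - t} \<le> 1 - \<alpha> - 2 * lo * t + up * (\<bar>l - q1\<bar> + \<bar>h - q2\<bar>)"
proof -
  have "cdf N (h - t) \<le> cdf N (q2 - t) + up * \<bar>h - q2\<bar>"
    using cdf_lipschitz[of "h - t" "q2 - t"] by simp
  moreover have "cdf N (q1 + t) - up * \<bar>l - q1\<bar> \<le> cdf N (l + t)"
    using cdf_lipschitz[of "q1 + t" "l + t"] by (simp add: abs_minus_commute)
  moreover have "lo * t \<le> cdf N q2 - cdf N (q2 - t)" "lo * t \<le> cdf N (q1 + t) - cdf N q1"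
    using cdf_increment_bounds(1)[of "q2 - t" q2] cdf_increment_bounds(1)[of q1 "q1 + t"]
      margins[OF assms(2)] assms(1) cdf_q1(2) cdf_q2(2) by auto
  \<comment> \<open>Without this, the truncation at \<open>0\<close> in the probability of an interval could spoil the upper bound.\<close>
  moreover have "2 * lo * t \<le> 1 - \<alpha>"
  proof -
    have "lo * t \<le> up * t" using lo_le_up assms(1) by (rule mult_right_mono)
    moreover have "2 * (up * t) \<le> 1 - \<alpha>" using assms(2) up_pos by (simp add: field_simps)
    ultimately show ?thesis by simp
  qed
  moreover have "0 \<le> up * (\<bar>l - q1\<bar> + \<bar>h - q2\<bar>)" using up_pos by simp
  ultimately show ?thesis
    unfolding prob_atLeastAtMost using cdf_q1(1) cdf_q2(1) by (simp add: algebra_simps)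
qed

lemma prob_perturbed:
  "\<bar>measure N {l..h} - (1 - \<alpha>)\<bar> \<le> up * (\<bar>l - q1\<bar> + \<bar>h - q2\<bar>)"
  unfolding prob_atLeastAtMost distrib_left
  using cdf_lipschitz[of l q1] cdf_lipschitz[of h q2] cdf_q1(1) cdf_q2(1) \<alpha>
  by (auto simp: max_def abs_if split: if_splits)

end

section \<open>The quantile of the weighted score distribution\<close>

lemma weighted_score_mass_eq:
  "weighted_score_mass w S m D x t =
     (\<Sum>j<m. w (fst (D j)) * indicator {..t} (S (fst (D j)) (snd (D j)))) / ((\<Sum>j<m. w (fst (D j))) + w x)"
  unfolding weighted_score_mass_def sum_divide_distrib by (rule sum.cong) simp_all

text \<open>
  The deterministic part of the argument.  Since the quantile at \<open>x\<close> is at most \<open>t\<close> as soon as the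
  centred sum at \<open>t\<close> reaches \<open>(1 - \<alpha>) w(x)\<close>, one takes the first grid point \<open>2\<^sup>k t0\<close> where the assumed
  growth exceeds this level.  By minimality it is at most twice as large as necessary, which
  explains the factor \<open>2\<close> in front of \<open>w(x)\<close>.  Growth is assumed up to \<open>\<rho>\<close> only; if \<open>\<rho>\<close> is passed, the
  factor \<open>2 M / \<rho>\<close> makes the claim weaker than the trivial bound by the range of the scores.
\<close>
lemma weighted_quantile_eq_real:
  fixes w :: "real ^ 'd::finite \<Rightarrow> real" and S :: "real ^ 'd \<Rightarrow> real \<Rightarrow> real" and D :: "nat \<Rightarrow> (real ^ 'd) \<times> real"
  defines "a \<equiv> \<lambda>j. w (fst (D j))" and "\<sigma> \<equiv> \<lambda>j. S (fst (D j)) (snd (D j))"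
  assumes a: "\<And>j. j < m \<Longrightarrow> 0 \<le> a j" and \<sigma>: "\<And>j. j < m \<Longrightarrow> -M \<le> \<sigma> j \<and> \<sigma> j \<le> 2 * M"
    and pos: "0 \<le> w x" "0 < (\<Sum>j<m. a j)" "0 < t0" "0 < \<rho>" "0 < lo" "0 < M" "\<alpha> < 1" "m \<ge> 1"
    and finite_level: "(1 - \<alpha>) * w x \<le> \<alpha> * (\<Sum>j<m. a j)"
    and lower: "t0 \<le> \<rho> \<Longrightarrow> (\<Sum>j<m. a j * (indicator {..-t0} (\<sigma> j) - (1 - \<alpha>))) < 0"
    and upper: "\<And>k. 2 ^ k * t0 \<le> \<rho> \<Longrightarrow>
        real m * (lo * (2 ^ k * t0)) \<le> (\<Sum>j<m. a j * (indicator {..2 ^ k * t0} (\<sigma> j) - (1 - \<alpha>)))"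
  shows "\<exists>q. weighted_quantile \<alpha> w S m D x = ereal q \<and>
           \<bar>q\<bar> \<le> max 1 (2 * M / \<rho>) * (t0 + 2 * (1 - \<alpha>) * w x / (real m * lo))"
proof -
  let ?Q = "weighted_quantile \<alpha> w S m D x" and ?F = "weighted_score_mass w S m D x"
  define A where "A = (\<lambda>t. \<Sum>j<m. a j * indicator {..t} (\<sigma> j))"
  define W where "W = (\<Sum>j<m. a j)"
  define T where "T = t0 + 2 * (1 - \<alpha>) * w x / (real m * lo)"
  define c where "c = max 1 (2 * M / \<rho>)"
  have F_iff: "1 - \<alpha> \<le> ?F t \<longleftrightarrow> (1 - \<alpha>) * (W + w x) \<le> A t" for t
    using pos by (simp add: weighted_score_mass_eq A_def a_def \<sigma>_def W_def pos_le_divide_eq)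
  have A_shift: "(\<Sum>j<m. a j * (indicator {..t} (\<sigma> j) - (1 - \<alpha>))) = A t - (1 - \<alpha>) * W" for t
    by (simp add: A_def W_def right_diff_distrib sum_subtractf sum_distrib_left mult.commute)
  have Q_le: "?Q \<le> ereal t" if "(1 - \<alpha>) * (W + w x) \<le> A t" for t
    unfolding weighted_quantile_def using that F_iff by (intro INF_lower) simp
  have A_mono: "A s \<le> A t" if "s \<le> t" for s t
    unfolding A_def using that a by (intro sum_mono mult_left_mono) (auto simp: indicator_def)
  have Q_ge: "ereal t \<le> ?Q" if "\<And>s. s < t \<Longrightarrow> A s < (1 - \<alpha>) * (W + w x)" for t
    unfolding weighted_quantile_def
  proof (rule INF_greatest)
    fix s assume "s \<in> {s. 1 - \<alpha> \<le> ?F s}"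
    then have "\<not> A s < (1 - \<alpha>) * (W + w x)" using F_iff by simp
    then show "ereal t \<le> ereal s" using that[of s] by force
  qed
  have T: "0 < T" "t0 \<le> T" using pos by (auto simp: T_def intro!: add_pos_nonneg)
  have c: "1 \<le> c" "2 * M / \<rho> \<le> c" by (auto simp: c_def)
  have T_le: "T \<le> c * T" using mult_right_mono[OF c(1), of T] T by simp
  have large: "2 * M \<le> c * T" if "\<rho> \<le> T"
  proof -
    have "2 * M = 2 * M / \<rho> * \<rho>" using pos by simp
    also have "\<dots> \<le> c * T" using c that pos by (intro mult_mono) auto
    finally show ?thesis .
  qed
  have W: "0 < W" using pos by (simp add: W_def)
  have Q_le_2M: "?Q \<le> ereal (2 * M)"
  proof (rule Q_le)
    have "A (2 * M) = W" unfolding A_def W_def using \<sigma> by (intro sum.cong) auto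
    then show "(1 - \<alpha>) * (W + w x) \<le> A (2 * M)" using finite_level by (simp add: algebra_simps W_def)
  qed
  have Q_ge_M: "ereal (-M) \<le> ?Q"
  proof (rule Q_ge)
    fix s assume "s < -M"
    then have "A s = 0" unfolding A_def using \<sigma> by (intro sum.neutral) (force simp: indicator_def)
    then show "A s < (1 - \<alpha>) * (W + w x)" using pos W by simp
  qed
  have up: "?Q \<le> ereal (c * T)"
  proof (cases "\<rho> \<le> T")
    case True
    then show ?thesis using Q_le_2M large by (metis ereal_less_eq(3) order_trans)
  next
    case False
    \<comment> \<open>\<open>P k\<close>: the grid point \<open>2\<^sup>k t0\<close> lies above the level belonging to \<open>x\<close>.\<close>
    define P where "P = (\<lambda>k. (1 - \<alpha>) * w x \<le> real m * (lo * (2 ^ k * t0)))"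
    have "\<exists>k. P k"
    proof -
      obtain k where "(1 - \<alpha>) * w x / (real m * lo * t0) < 2 ^ k"
        using real_arch_pow[of 2] by auto
      then have "P k" using pos by (simp add: P_def field_simps)
      then show ?thesis ..
    qed
    define k where "k = (LEAST k. P k)"
    have Pk: "P k" unfolding k_def using \<open>\<exists>k. P k\<close> by (rule LeastI_ex)
    have kT: "2 ^ k * t0 \<le> T"
    proof (cases k)
      case 0
      then show ?thesis using T by simp
    next
      case (Suc j)
      then have "\<not> P j" unfolding k_def by (metis lessI not_less_Least)
      then have "real m * (lo * (2 ^ j * t0)) \<le> (1 - \<alpha>) * w x" by (simp add: P_def)
      then have "2 ^ k * t0 \<le> 2 * (1 - \<alpha>) * w x / (real m * lo)"
        using pos Suc by (simp add: field_simps)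
      then show ?thesis using pos by (simp add: T_def)
    qed
    have "real m * (lo * (2 ^ k * t0)) \<le> A (2 ^ k * t0) - (1 - \<alpha>) * W"
      using upper[of k] kT False by (simp add: A_shift)
    then have "?Q \<le> ereal (2 ^ k * t0)" using Pk by (intro Q_le) (simp add: P_def distrib_left)
    then show ?thesis using kT T_le by (metis ereal_less_eq(3) order_trans)
  qed
  have low: "ereal (- (c * T)) \<le> ?Q"
  proof (cases "t0 \<le> \<rho>")
    case True
    have "ereal (-t0) \<le> ?Q"
    proof (rule Q_ge)
      fix s assume "s < -t0"
      then have "A s \<le> A (-t0)" by (intro A_mono) simp
      also have "\<dots> < (1 - \<alpha>) * W" using lower[OF True] by (simp add: A_shift)
      also have "\<dots> \<le> (1 - \<alpha>) * (W + w x)" using pos by (simp add: mult_left_mono)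
      finally show "A s < (1 - \<alpha>) * (W + w x)" .
    qed
    moreover have "- (c * T) \<le> -t0" using T T_le by linarith
    ultimately show ?thesis by (metis ereal_less_eq(3) order_trans)
  next
    case False
    then have "- (c * T) \<le> -M" using large T pos by simp
    then show ?thesis using Q_ge_M by (metis ereal_less_eq(3) order_trans)
  qed
  obtain q where "?Q = ereal q" using up low by (cases ?Q) auto
  then show ?thesis using up low by (auto simp: c_def T_def abs_le_iff)
qed

section \<open>Extended L2 norms\<close>

lemma L2_enorm_le:
  assumes "\<And>x. x \<in> space N \<Longrightarrow> \<bar>g x\<bar> \<le> ereal (h x)"
    and "(\<integral>\<^sup>+ x. ennreal ((h x)\<^sup>2) \<partial>N) \<le> ennreal (B\<^sup>2)" and "0 \<le> B"
  shows "L2_enorm N g \<le> ennreal B"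
proof -
  define I where "I = (\<integral>\<^sup>+ x. (e2ennreal \<bar>g x\<bar>)\<^sup>2 \<partial>N)"
  have "I \<le> (\<integral>\<^sup>+ x. ennreal ((h x)\<^sup>2) \<partial>N)"
    unfolding I_def
  proof (rule nn_integral_mono)
    fix x assume x: "x \<in> space N"
    have h: "0 \<le> h x" using assms(1)[OF x] by (cases "g x") auto
    have "e2ennreal \<bar>g x\<bar> \<le> ennreal (h x)" using e2ennreal_mono[OF assms(1)[OF x]] by simp
    then have "(e2ennreal \<bar>g x\<bar>)\<^sup>2 \<le> (ennreal (h x))\<^sup>2" by (rule power_mono_ennreal)
    then show "(e2ennreal \<bar>g x\<bar>)\<^sup>2 \<le> ennreal ((h x)\<^sup>2)" using h by (simp add: ennreal_power)
  qed
  also note assms(2)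
  finally have I: "I \<le> ennreal (B\<^sup>2)" .
  then have "I \<noteq> \<top>" by (auto simp: top_unique)
  moreover have "enn2real I \<le> B\<^sup>2" using I by (rule enn2real_leI[rotated]) simp
  then have "sqrt (enn2real I) \<le> B" using assms(3) by (intro real_le_lsqrt) auto
  ultimately show ?thesis by (simp add: L2_enorm_def I_def[symmetric] ennreal_leI)
qed

lemma L2_enorm_leD:
  fixes g :: "'a \<Rightarrow> real"
  assumes "L2_enorm N (\<lambda>x. ereal (g x)) \<le> ennreal B" and int: "integrable N (\<lambda>x. (g x)\<^sup>2)" and B: "0 \<le> B"
  shows "(\<integral>x. (g x)\<^sup>2 \<partial>N) \<le> B\<^sup>2"
proof -
  have "(\<integral>\<^sup>+ x. (e2ennreal \<bar>ereal (g x)\<bar>)\<^sup>2 \<partial>N) = (\<integral>\<^sup>+ x. ennreal ((g x)\<^sup>2) \<partial>N)"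
    by (simp add: ennreal_power)
  also have "\<dots> = ennreal (\<integral>x. (g x)\<^sup>2 \<partial>N)"
    using int by (intro nn_integral_eq_integral) auto
  finally have "ennreal (sqrt (\<integral>x. (g x)\<^sup>2 \<partial>N)) \<le> ennreal B"
    using assms(1) by (simp add: L2_enorm_def)
  then have "sqrt (\<integral>x. (g x)\<^sup>2 \<partial>N) \<le> B" using B by simp
  then show ?thesis using real_le_rsqrt sqrt_le_D by blast
qed

section \<open>Covariate shift: conditional laws and samples\<close>

text \<open>
  Boundedness, density and known covariate shift.  Smoothness acts through the accuracy of
  the fitted endpoints, which is a parameter further below.
\<close>
locale covariate_shift_model =
  fixes \<alpha> \<mu>low \<mu>up M wmax :: real and P Q :: "(real ^ 'd::finite) measure"
    and \<kappa> :: "real ^ 'd \<Rightarrow> real measure" and w :: "real ^ 'd \<Rightarrow> real"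
  assumes \<alpha>: "0 < \<alpha>" "\<alpha> < 1" and \<mu>low_pos: "0 < \<mu>low" and M_pos: "0 < M"
    and model: "bounded_model M P \<kappa>" and dens: "density_condition M \<mu>low \<mu>up \<kappa>"
    and shift: "covariate_shift P Q w wmax"
begin

sublocale P: prob_space P
  using model by (simp add: bounded_model_def)

sublocale Q: prob_space Q
  by (rule shift[unfolded covariate_shift_def, THEN conjunct1])

lemma sets_P [measurable_cong, simp]: "sets P = sets cube_borel"
  using model by (simp add: bounded_model_def)

lemma space_P [simp]: "space P = cube"
  using sets_eq_imp_space_eq[OF sets_P] by (simp add: space_restrict_space)

lemma cube_nonempty [simp]: "(cube :: (real ^ 'd) set) \<noteq> {}"
  using P.not_empty by simp

lemma prob_cube [simp]: "measure P cube = 1"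
  using P.prob_space by simp

lemma Q_eq: "Q = density P (\<lambda>x. ennreal (w x))"
  using shift by (simp add: covariate_shift_def)

lemma sets_Q [measurable_cong, simp]: "sets Q = sets cube_borel"
  by (simp add: Q_eq)

lemma space_Q [simp]: "space Q = cube"
  by (simp add: Q_eq)

lemma kernel [measurable]: "\<kappa> \<in> cube_borel \<rightarrow>\<^sub>M prob_algebra borel"
  using model by (simp add: bounded_model_def)

lemma w_meas [measurable]: "w \<in> borel_measurable cube_borel"
  using shift measurable_cong_sets[OF sets_P refl] by (auto simp: covariate_shift_def)

lemma w_bounds: "x \<in> cube \<Longrightarrow> 0 \<le> w x" "x \<in> cube \<Longrightarrow> w x \<le> wmax"
  using shift by (auto simp: covariate_shift_def)

lemma space_cube_borel [simp]: "space cube_borel = cube"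
  by (simp add: space_restrict_space)

lemma prob_kernel: "x \<in> cube \<Longrightarrow> prob_space (\<kappa> x)" and sets_kernel_at: "x \<in> cube \<Longrightarrow> sets (\<kappa> x) = sets borel"
  using measurable_space[OF kernel, of x] by (auto simp: space_prob_algebra)

lemma conditional_law:
  assumes "x \<in> cube"
  shows "\<exists>p. two_sided_density_level (\<kappa> x) p \<mu>low \<mu>up M \<alpha>
               (cond_quantile \<kappa> (\<alpha>/2) x) (cond_quantile \<kappa> (1 - \<alpha>/2) x)"
proof -
  obtain p where "p \<in> borel_measurable borel" "\<kappa> x = density lborel (\<lambda>y. ennreal (p y))"
      "\<forall>y\<in>{-M..M}. \<mu>low \<le> p y \<and> p y \<le> \<mu>up"
    using dens assms unfolding density_condition_def by blast
  moreover have "measure (\<kappa> x) {-M..M} = 1" using model assms by (simp add: bounded_model_def)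
  ultimately show ?thesis
    using prob_kernel[OF assms] \<alpha> \<mu>low_pos M_pos
    by (intro exI[of _ p] two_sided_density_level.intro two_sided_density.intro
        two_sided_density_level_axioms.intro) (blast | simp only: cond_quantile_def cdf_def)+
qed

lemma cond_quantile_bounds:
  assumes "x \<in> cube"
  shows "\<bar>cond_quantile \<kappa> (\<alpha>/2) x\<bar> \<le> M" "\<bar>cond_quantile \<kappa> (1 - \<alpha>/2) x\<bar> \<le> M"
    and "cond_quantile \<kappa> (\<alpha>/2) x \<le> cond_quantile \<kappa> (1 - \<alpha>/2) x"
proof -
  obtain p where "two_sided_density_level (\<kappa> x) p \<mu>low \<mu>up M \<alpha>
               (cond_quantile \<kappa> (\<alpha>/2) x) (cond_quantile \<kappa> (1 - \<alpha>/2) x)"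
    using conditional_law[OF assms] by auto
  then interpret two_sided_density_level "\<kappa> x" p \<mu>low \<mu>up M \<alpha>
    "cond_quantile \<kappa> (\<alpha>/2) x" "cond_quantile \<kappa> (1 - \<alpha>/2) x" .
  show "\<bar>cond_quantile \<kappa> (\<alpha>/2) x\<bar> \<le> M" "\<bar>cond_quantile \<kappa> (1 - \<alpha>/2) x\<bar> \<le> M"
      "cond_quantile \<kappa> (\<alpha>/2) x \<le> cond_quantile \<kappa> (1 - \<alpha>/2) x"
    using cdf_q1 cdf_q2 q1_le_q2 by auto
qed

lemma \<mu>up_pos: "0 < \<mu>up"
proof -
  obtain x :: "real ^ 'd" where x: "x \<in> cube" using cube_nonempty by blast
  obtain p where "two_sided_density_level (\<kappa> x) p \<mu>low \<mu>up M \<alpha>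
               (cond_quantile \<kappa> (\<alpha>/2) x) (cond_quantile \<kappa> (1 - \<alpha>/2) x)"
    using conditional_law[OF x] by auto
  then interpret two_sided_density_level "\<kappa> x" p \<mu>low \<mu>up M \<alpha>
    "cond_quantile \<kappa> (\<alpha>/2) x" "cond_quantile \<kappa> (1 - \<alpha>/2) x" .
  show ?thesis by (rule up_pos)
qed

lemma cond_quantile_meas:
  assumes "0 < \<tau>" "\<tau> < 1"
  shows "cond_quantile \<kappa> \<tau> \<in> borel_measurable cube_borel"
proof (subst borel_measurable_iff_le, intro allI)
  fix a
  have "{x \<in> space cube_borel. cond_quantile \<kappa> \<tau> x \<le> a} = {x \<in> space cube_borel. \<tau> \<le> measure (\<kappa> x) {..a}}"
  proof (intro Collect_cong conj_cong refl)
    fix x :: "real ^ 'd" assume "x \<in> space cube_borel"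
    then obtain p where "two_sided_density_level (\<kappa> x) p \<mu>low \<mu>up M \<alpha>
               (cond_quantile \<kappa> (\<alpha>/2) x) (cond_quantile \<kappa> (1 - \<alpha>/2) x)"
      using conditional_law[of x] by auto
    then interpret two_sided_density_level "\<kappa> x" p \<mu>low \<mu>up M \<alpha>
      "cond_quantile \<kappa> (\<alpha>/2) x" "cond_quantile \<kappa> (1 - \<alpha>/2) x" .
    show "(cond_quantile \<kappa> \<tau> x \<le> a) = (\<tau> \<le> measure (\<kappa> x) {..a})"
      using quantile_le_iff[OF assms] by (simp add: cond_quantile_def cdf_def)
  qed
  also have "\<dots> \<in> sets cube_borel" by measurable
  finally show "{x \<in> space cube_borel. cond_quantile \<kappa> \<tau> x \<le> a} \<in> sets cube_borel" .
qed

lemma integral_Q: "g \<in> borel_measurable cube_borel \<Longrightarrow> (\<integral>x. g x \<partial>Q) = (\<integral>x. w x * g x \<partial>P)" for g :: "_ \<Rightarrow> real"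
  unfolding Q_eq using w_bounds by (subst integral_density) auto

lemma integrable_bounded:
  fixes g :: "real ^ 'd \<Rightarrow> real"
  assumes "g \<in> borel_measurable cube_borel" "\<And>x. x \<in> cube \<Longrightarrow> \<bar>g x\<bar> \<le> B"
  shows "integrable P g"
  using assms by (intro P.integrable_const_bound[where B = B]) auto

lemma integrable_Q:
  fixes g :: "real ^ 'd \<Rightarrow> real"
  assumes "g \<in> borel_measurable cube_borel" "\<And>x. x \<in> cube \<Longrightarrow> \<bar>g x\<bar> \<le> B"
  shows "integrable Q g"
  using assms by (intro Q.integrable_const_bound[where B = B]) auto

lemma w_sq_le: "x \<in> cube \<Longrightarrow> (w x)\<^sup>2 \<le> wmax\<^sup>2"
  using w_bounds by (intro power_mono) auto

lemma integrable_w: "integrable P w" and integrable_w2: "integrable P (\<lambda>x. (w x)\<^sup>2)"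
proof -
  show "integrable P w"
    using w_bounds by (intro P.integrable_const_bound[where B = wmax]) auto
  show "integrable P (\<lambda>x. (w x)\<^sup>2)"
    using w_bounds by (intro P.integrable_const_bound[where B = "wmax\<^sup>2"]) (auto intro!: power_mono)
qed

lemma integral_w: "(\<integral>x. w x \<partial>P) = 1"
  using integral_Q[of "\<lambda>_. 1"] Q.prob_space by simp

text \<open>
  The second moment of \<open>w\<close> is the effective variance in all concentration bounds.
\<close>
lemma integral_w2: "(\<integral>x. (w x)\<^sup>2 \<partial>P) = 1 + chi2 P w"
  unfolding chi2_def power2_diff using integrable_w integrable_w2
  by (simp add: integral_w P.prob_space)

lemma wmax_ge_1: "1 \<le> wmax"
proof -
  have "(\<integral>x. w x \<partial>P) \<le> (\<integral>x. wmax \<partial>P)"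
    using w_bounds integrable_w by (intro integral_mono_AE) auto
  then show ?thesis by (simp add: integral_w P.prob_space)
qed

lemma chi2_nonneg: "0 \<le> chi2 P w"
  by (simp add: chi2_def)

lemma joint_kernel [measurable]: "(\<lambda>x. distr (\<kappa> x) obs_space (\<lambda>y. (x, y))) \<in> P \<rightarrow>\<^sub>M prob_algebra obs_space"
  by measurable

lemma sets_joint [measurable_cong, simp]: "sets (joint_law P \<kappa>) = sets obs_space"
  unfolding joint_law_def by (rule sets_bind) (auto simp: P.not_empty)

lemma space_joint [simp]: "space (joint_law P \<kappa>) = cube \<times> UNIV"
  using sets_eq_imp_space_eq[OF sets_joint] by (simp add: space_pair_measure)

lemma prob_joint: "prob_space (joint_law P \<kappa>)"
  unfolding joint_law_def
  by (rule prob_space_bind'[OF _ joint_kernel]) (simp add: space_prob_algebra P.prob_space_axioms)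

lemma integrable_joint:
  fixes g :: "(real ^ 'd) \<times> real \<Rightarrow> real"
  assumes "g \<in> borel_measurable obs_space" "\<And>x y. x \<in> cube \<Longrightarrow> \<bar>g (x, y)\<bar> \<le> B"
  shows "integrable (joint_law P \<kappa>) g"
proof -
  interpret J: prob_space "joint_law P \<kappa>" by (rule prob_joint)
  show ?thesis using assms by (intro J.integrable_const_bound[where B = B]) auto
qed

lemma integral_joint:
  fixes g :: "(real ^ 'd) \<times> real \<Rightarrow> real"
  assumes g [measurable]: "g \<in> borel_measurable obs_space" and B: "\<And>x y. x \<in> cube \<Longrightarrow> \<bar>g (x, y)\<bar> \<le> B"
  shows "(\<integral>z. g z \<partial>joint_law P \<kappa>) = (\<integral>x. (\<integral>y. g (x, y) \<partial>\<kappa> x) \<partial>P)"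
proof -
  have "(\<integral>z. g z \<partial>joint_law P \<kappa>) = (\<integral>x. (\<integral>z. g z \<partial>distr (\<kappa> x) obs_space (\<lambda>y. (x, y))) \<partial>P)"
    unfolding joint_law_def
  proof (rule integral_bind[where K = obs_space and B = B and B' = 1])
    show "finite_measure P" by (rule P.finite_measure_axioms)
    show "AE x in P. emeasure (distr (\<kappa> x) obs_space (Pair x)) (space (distr (\<kappa> x) obs_space (Pair x))) \<le> ennreal 1"
    proof (rule AE_I2)
      fix x assume "x \<in> space P"
      then have "prob_space (distr (\<kappa> x) obs_space (Pair x))"
        using measurable_space[OF joint_kernel, of x] by (simp add: space_prob_algebra)
      from prob_space.emeasure_space_1[OF this] show "emeasure (distr (\<kappa> x) obs_space (Pair x)) (space (distr (\<kappa> x) obs_space (Pair x))) \<le> ennreal 1"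
        by simp
    qed
    show "(\<lambda>x. distr (\<kappa> x) obs_space (Pair x)) \<in> P \<rightarrow>\<^sub>M subprob_algebra obs_space"
      by (rule measurable_prob_algebraD[OF joint_kernel])
    show "\<bar>g z\<bar> \<le> B" if "z \<in> space obs_space" for z
      using B that by (cases z) (auto simp: space_pair_measure)
  qed (rule g)
  also have "\<dots> = (\<integral>x. (\<integral>y. g (x, y) \<partial>\<kappa> x) \<partial>P)"
  proof (rule Bochner_Integration.integral_cong[OF refl])
    fix x assume x: "x \<in> space P"
    have [measurable_cong]: "sets (\<kappa> x) = sets borel" using x sets_kernel_at by simp
    show "(\<integral>z. g z \<partial>distr (\<kappa> x) obs_space (\<lambda>y. (x, y))) = (\<integral>y. g (x, y) \<partial>\<kappa> x)"
      using x by (intro integral_distr) auto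
  qed
  finally show ?thesis .
qed

text \<open>
  The sample space admits arbitrary real responses; bounds on the scores and on the fitted
  endpoints are only available when all responses lie in \<open>[-M, M]\<close>.
\<close>
lemma AE_joint_response: "AE z in joint_law P \<kappa>. snd z \<in> {-M..M}"
proof -
  have "AE x in P. AE z in distr (\<kappa> x) obs_space (\<lambda>y. (x, y)). snd z \<in> {-M..M}"
  proof (rule AE_I2)
    fix x assume x: "x \<in> space P"
    have [measurable_cong]: "sets (\<kappa> x) = sets borel" using x sets_kernel_at by simp
    interpret \<kappa>x: prob_space "\<kappa> x" using x prob_kernel by simp
    have "AE y in \<kappa> x. y \<in> {-M..M}"
      using model x by (intro \<kappa>x.AE_prob_1) (simp add: bounded_model_def)
    then show "AE z in distr (\<kappa> x) obs_space (\<lambda>y. (x, y)). snd z \<in> {-M..M}"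
      using x by (subst AE_distr_iff) auto
  qed
  then show ?thesis
    unfolding joint_law_def by (subst AE_bind[OF measurable_prob_algebraD[OF joint_kernel]]) auto
qed

lemma sets_sample_law [measurable_cong]: "sets (sample_law m P \<kappa>) = sets (\<Pi>\<^sub>M i\<in>{..<m}. obs_space)"
  unfolding sample_law_def by (rule sets_PiM_cong) auto

lemma prob_sample_law: "prob_space (sample_law m P \<kappa>)"
  unfolding sample_law_def by (intro prob_space_PiM prob_joint)

lemma space_sample_law: "space (sample_law m P \<kappa>) = ({..<m} \<rightarrow>\<^sub>E cube \<times> UNIV)"
  unfolding sample_law_def by (simp add: space_PiM)

lemma AE_sample_response:
  "AE D in sample_law m P \<kappa>. \<forall>j<m. snd (D j) \<in> {-M..M}"
proof -
  have "AE D in sample_law m P \<kappa>. \<forall>j\<in>{..<m}. snd (D j) \<in> {-M..M}"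
  proof (rule AE_finite_allI)
    show "AE D in sample_law m P \<kappa>. snd (D j) \<in> {-M..M}" if "j \<in> {..<m}" for j
      unfolding sample_law_def
      by (rule AE_PiM_component[OF prob_joint that AE_joint_response])
  qed simp
  then show ?thesis by (simp only: Ball_def lessThan_iff)
qed

end

section \<open>Mean coverage of the fitted intervals under the target law\<close>

text \<open>
  The situation for one fixed training sample: \<open>f1\<close> and \<open>f2\<close> are the raw endpoints.  The L2 bounds are
  stated with the squared norm, which is finite because all functions are bounded.
\<close>
locale fitted_endpoints = covariate_shift_model \<alpha> \<mu>low \<mu>up M wmax P Q \<kappa> w
  for \<alpha> \<mu>low \<mu>up M wmax :: real and P Q :: "(real ^ 'd::finite) measure"
    and \<kappa> :: "real ^ 'd \<Rightarrow> real measure" and w :: "real ^ 'd \<Rightarrow> real" +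
  fixes f1 f2 :: "real ^ 'd \<Rightarrow> real" and \<epsilon> :: real
  assumes f_meas [measurable]: "f1 \<in> borel_measurable cube_borel" "f2 \<in> borel_measurable cube_borel"
    and f_bounds: "\<And>x. x \<in> cube \<Longrightarrow> \<bar>f1 x\<bar> \<le> M" "\<And>x. x \<in> cube \<Longrightarrow> \<bar>f2 x\<bar> \<le> M"
    and \<epsilon>_pos: "0 < \<epsilon>"
    and f1_error: "(\<integral>x. (f1 x - cond_quantile \<kappa> (\<alpha>/2) x)\<^sup>2 \<partial>P) \<le> \<epsilon>\<^sup>2"
    and f2_error: "(\<integral>x. (f2 x - cond_quantile \<kappa> (1 - \<alpha>/2) x)\<^sup>2 \<partial>P) \<le> \<epsilon>\<^sup>2"
begin

abbreviation "q1 \<equiv> cond_quantile \<kappa> (\<alpha>/2)"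
abbreviation "q2 \<equiv> cond_quantile \<kappa> (1 - \<alpha>/2)"
abbreviation "lo \<equiv> \<lambda>x. min (f1 x) (f2 x)"
abbreviation "hi \<equiv> \<lambda>x. max (f1 x) (f2 x)"
abbreviation "score \<equiv> cqr_score lo hi"

definition gap :: "real ^ 'd \<Rightarrow> real" where
  "gap x = \<bar>f1 x - q1 x\<bar> + \<bar>f2 x - q2 x\<bar>"

text \<open>
  The weighted coverage, centred at the nominal level, that one observation contributes when the fitted
  interval is enlarged by \<open>t\<close>.
\<close>
definition excess :: "real \<Rightarrow> (real ^ 'd) \<times> real \<Rightarrow> real" where
  "excess t z = w (fst z) * (indicator {..t} (score (fst z) (snd z)) - (1 - \<alpha>))"

lemma q_meas [measurable]: "q1 \<in> borel_measurable cube_borel" "q2 \<in> borel_measurable cube_borel"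
  using \<alpha> by (auto intro!: cond_quantile_meas)

text \<open>
  Rearrangement: as the conditional quantiles are ordered, ordering their estimates cannot increase the
  total error.
\<close>
lemma sorting_contracts: "x \<in> cube \<Longrightarrow> \<bar>lo x - q1 x\<bar> + \<bar>hi x - q2 x\<bar> \<le> gap x"
  using cond_quantile_bounds(3)[of x] by (auto simp: gap_def min_def max_def abs_if)

lemma gap_meas [measurable]: "gap \<in> borel_measurable cube_borel"
  unfolding gap_def by measurable

lemma gap_nonneg: "0 \<le> gap x"
  by (simp add: gap_def)

lemma gap_le: "x \<in> cube \<Longrightarrow> gap x \<le> 4 * M"
  using f_bounds[of x] cond_quantile_bounds[of x] by (simp add: gap_def)

lemma gap2_le: "x \<in> cube \<Longrightarrow> (gap x)\<^sup>2 \<le> (4 * M)\<^sup>2"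
  using gap_le gap_nonneg by (intro power_mono) auto

lemma integrable_gap2: "integrable P (\<lambda>x. (gap x)\<^sup>2)"
  by (rule integrable_bounded[where B = "(4 * M)\<^sup>2"]) (use gap2_le in auto)

lemma integral_gap2: "(\<integral>x. (gap x)\<^sup>2 \<partial>P) \<le> (2 * \<epsilon>)\<^sup>2"
proof -
  have bd: "(f - q)\<^sup>2 \<le> (2 * M)\<^sup>2" if "\<bar>f\<bar> \<le> M" "\<bar>q\<bar> \<le> M" for f q :: real
    using that by (subst abs_le_square_iff[symmetric]) auto
  have int: "integrable P (\<lambda>x. (f1 x - q1 x)\<^sup>2)" "integrable P (\<lambda>x. (f2 x - q2 x)\<^sup>2)"
    using f_bounds cond_quantile_bounds bd
    by (auto intro!: P.integrable_const_bound[where B = "(2 * M)\<^sup>2"])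
  have "(\<integral>x. (gap x)\<^sup>2 \<partial>P) \<le> (\<integral>x. 2 * (f1 x - q1 x)\<^sup>2 + 2 * (f2 x - q2 x)\<^sup>2 \<partial>P)"
  proof (rule integral_mono[OF integrable_gap2])
    fix x
    have "0 \<le> (\<bar>f1 x - q1 x\<bar> - \<bar>f2 x - q2 x\<bar>)\<^sup>2" by simp
    then show "(gap x)\<^sup>2 \<le> 2 * (f1 x - q1 x)\<^sup>2 + 2 * (f2 x - q2 x)\<^sup>2"
      by (simp add: gap_def power2_sum power2_diff)
  qed (use int in auto)
  also have "\<dots> \<le> (2 * \<epsilon>)\<^sup>2" using int f1_error f2_error by (simp add: power_mult_distrib)
  finally show ?thesis .
qed

lemma integral_w_gap2: "(\<integral>x. w x * (gap x)\<^sup>2 \<partial>P) \<le> wmax * (2 * \<epsilon>)\<^sup>2"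
  and integrable_w_gap2: "integrable P (\<lambda>x. w x * (gap x)\<^sup>2)"
proof -
  show int: "integrable P (\<lambda>x. w x * (gap x)\<^sup>2)"
  proof (rule integrable_bounded)
    show "\<bar>w x * (gap x)\<^sup>2\<bar> \<le> wmax * (4 * M)\<^sup>2" if "x \<in> cube" for x
      using mult_mono[OF w_bounds(2)[OF that] gap2_le[OF that]] w_bounds(1)[OF that] wmax_ge_1
      by (simp add: abs_mult)
  qed simp
  have "(\<integral>x. w x * (gap x)\<^sup>2 \<partial>P) \<le> (\<integral>x. wmax * (gap x)\<^sup>2 \<partial>P)"
    using int integrable_gap2 w_bounds by (intro integral_mono_AE) (auto intro!: mult_right_mono)
  also have "\<dots> \<le> wmax * (2 * \<epsilon>)\<^sup>2"
    using integral_gap2 wmax_ge_1 by (simp add: mult_left_mono)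
  finally show "(\<integral>x. w x * (gap x)\<^sup>2 \<partial>P) \<le> wmax * (2 * \<epsilon>)\<^sup>2" .
qed

lemma integrable_w_gap: "integrable P (\<lambda>x. w x * gap x)"
proof (rule integrable_bounded)
  show "\<bar>w x * gap x\<bar> \<le> wmax * (4 * M)" if "x \<in> cube" for x
    using mult_mono[OF w_bounds(2)[OF that] gap_le[OF that]] w_bounds(1)[OF that] wmax_ge_1 gap_nonneg[of x]
    by (simp add: abs_mult)
qed simp

text \<open>
  A bound on the \<open>Q\<close>-mean of the endpoint error by its L2(P) norm.  The square root of \<open>wmax\<close> arises
  from \<open>\<integral> gap\<^sup>2 dQ \<le> wmax \<integral> gap\<^sup>2 dP\<close>.
\<close>
lemma integral_w_gap: "(\<integral>x. w x * gap x \<partial>P) \<le> 2 * sqrt wmax * \<epsilon>"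
proof -
  \<comment> \<open>\<open>gap \<le> a / 2 + gap\<^sup>2 / (2 a)\<close>, with the value of \<open>a\<close> at which both terms have the same integral bound.\<close>
  define a where "a = 2 * sqrt wmax * \<epsilon>"
  have a: "0 < a" using wmax_ge_1 \<epsilon>_pos by (simp add: a_def)
  have "(\<integral>x. w x * gap x \<partial>P) \<le> (\<integral>x. a / 2 * w x + 1 / (2 * a) * (w x * (gap x)\<^sup>2) \<partial>P)"
  proof (rule integral_mono_AE[OF integrable_w_gap])
    show "AE x in P. w x * gap x \<le> a / 2 * w x + 1 / (2 * a) * (w x * (gap x)\<^sup>2)"
    proof (rule AE_I2)
      fix x assume "x \<in> space P"
      then have "0 \<le> w x * (gap x - a)\<^sup>2" using w_bounds by simp
      then have "2 * a * (w x * gap x) \<le> 2 * a * (a / 2 * w x + 1 / (2 * a) * (w x * (gap x)\<^sup>2))"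
        using a by (simp add: power2_diff algebra_simps power2_eq_square)
      then show "w x * gap x \<le> a / 2 * w x + 1 / (2 * a) * (w x * (gap x)\<^sup>2)" using a by simp
    qed
  qed (use integrable_w integrable_w_gap2 in auto)
  also have "\<dots> = a / 2 + 1 / (2 * a) * (\<integral>x. w x * (gap x)\<^sup>2 \<partial>P)"
    using integrable_w integrable_w_gap2 by (simp add: integral_w)
  also have "\<dots> \<le> a / 2 + 1 / (2 * a) * a\<^sup>2"
    using integral_w_gap2 a wmax_ge_1
    by (intro add_left_mono mult_left_mono) (auto simp: a_def power_mult_distrib)
  also have "\<dots> = a" using a by (simp add: power2_eq_square)
  finally show ?thesis by (simp add: a_def)
qed

lemma score_meas [measurable]: "(\<lambda>z. score (fst z) (snd z)) \<in> borel_measurable obs_space"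
  unfolding cqr_score_def by measurable

lemma excess_meas [measurable]: "excess t \<in> borel_measurable obs_space"
  unfolding excess_def by measurable

lemma abs_excess_le: "x \<in> cube \<Longrightarrow> \<bar>excess t (x, y)\<bar> \<le> w x"
  using w_bounds[of x] \<alpha> by (auto simp: excess_def abs_mult indicator_def mult_left_le)

lemma integral_excess:
  "(\<integral>z. excess t z \<partial>joint_law P \<kappa>) =
     (\<integral>x. w x * (measure (\<kappa> x) {lo x - t..hi x + t} - (1 - \<alpha>)) \<partial>P)"
proof -
  have "(\<integral>z. excess t z \<partial>joint_law P \<kappa>) = (\<integral>x. (\<integral>y. excess t (x, y) \<partial>\<kappa> x) \<partial>P)"
    by (rule integral_joint[OF excess_meas]) (rule order_trans[OF abs_excess_le w_bounds(2)])
  also have "\<dots> = (\<integral>x. w x * (measure (\<kappa> x) {lo x - t..hi x + t} - (1 - \<alpha>)) \<partial>P)"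
  proof (rule Bochner_Integration.integral_cong[OF refl])
    fix x assume "x \<in> space P"
    then interpret \<kappa>x: prob_space "\<kappa> x" using prob_kernel by simp
    have [measurable_cong]: "sets (\<kappa> x) = sets borel" using \<open>x \<in> space P\<close> sets_kernel_at by simp
    have "(\<integral>y. excess t (x, y) \<partial>\<kappa> x)
        = (\<integral>y. w x * (indicator {lo x - t..hi x + t} y - (1 - \<alpha>)) \<partial>\<kappa> x)"
      by (intro Bochner_Integration.integral_cong refl)
         (auto simp: excess_def cqr_score_def indicator_def max_def min_def)
    also have "\<dots> = w x * (measure (\<kappa> x) {lo x - t..hi x + t} - (1 - \<alpha>))"
      by (simp add: \<kappa>x.emeasure_eq_measure \<kappa>x.prob_space)
    finally show "(\<integral>y. excess t (x, y) \<partial>\<kappa> x)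
        = w x * (measure (\<kappa> x) {lo x - t..hi x + t} - (1 - \<alpha>))" .
  qed
  finally show ?thesis .
qed

lemma integral_affine_gap:
  "(\<integral>x. w x * (c + d * gap x) \<partial>P) = c + d * (\<integral>x. w x * gap x \<partial>P)"
  "integrable P (\<lambda>x. w x * (c + d * gap x))"
  using integrable_w integrable_w_gap
  by (simp_all add: distrib_left integral_w mult.left_commute[of _ d] mult.commute[of _ c])

lemma interval_prob_meas [measurable]:
  "(\<lambda>x. measure (\<kappa> x) {lo x - t..hi x + t}) \<in> borel_measurable cube_borel"
proof (rule measure_measurable_prob_algebra2[OF _ kernel])
  have "(SIGMA x:space cube_borel. {lo x - t..hi x + t})
      = {z \<in> space (cube_borel \<Otimes>\<^sub>M borel). lo (fst z) - t \<le> snd z \<and> snd z \<le> hi (fst z) + t}"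
    by (auto simp: space_pair_measure)
  also have "\<dots> \<in> sets (cube_borel \<Otimes>\<^sub>M borel)" by measurable
  finally show "(SIGMA x:space cube_borel. {lo x - t..hi x + t}) \<in> sets (cube_borel \<Otimes>\<^sub>M borel)" .
qed

lemma integrable_interval_prob:
  "integrable P (\<lambda>x. w x * (measure (\<kappa> x) {lo x - t..hi x + t} - (1 - \<alpha>)))"
proof (rule P.integrable_const_bound[where B = wmax])
  show "AE x in P. norm (w x * (measure (\<kappa> x) {lo x - t..hi x + t} - (1 - \<alpha>))) \<le> wmax"
  proof (rule AE_I2)
    fix x assume "x \<in> space P"
    then interpret \<kappa>x: prob_space "\<kappa> x" using prob_kernel by simp
    have "\<bar>measure (\<kappa> x) {lo x - t..hi x + t} - (1 - \<alpha>)\<bar> \<le> 1"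
      using \<kappa>x.prob_le_1[of "{lo x - t..hi x + t}"] measure_nonneg[of "\<kappa> x" "{lo x - t..hi x + t}"] \<alpha> by linarith
    then show "norm (w x * (measure (\<kappa> x) {lo x - t..hi x + t} - (1 - \<alpha>))) \<le> wmax"
      using w_bounds[of x] \<open>x \<in> space P\<close> mult_mono[of "w x" wmax _ 1] by (simp add: abs_mult)
  qed
qed simp

text \<open>
  Up to this radius the density bounds act on both sides of both conditional quantiles.
\<close>
definition "\<rho> = min \<alpha> (1 - \<alpha>) / (2 * \<mu>up)"

lemma \<rho>_pos: "0 < \<rho>"
  using \<alpha> \<mu>up_pos by (simp add: \<rho>_def)

lemma gap_bound: assumes x: "x \<in> cube"
  shows "\<mu>up * (\<bar>lo x - q1 x\<bar> + \<bar>hi x - q2 x\<bar>) \<le> \<mu>up * gap x"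
  using sorting_contracts[OF x] \<mu>up_pos by (simp add: mult_left_mono)

text \<open>
  Growth of the mean excess, obtained by averaging the conditional estimates over \<open>Q\<close>.  The bias is
  the price for using fitted instead of true quantiles.
\<close>
lemma mean_excess_widened:
  assumes "0 \<le> t" "t \<le> \<rho>"
  shows "2 * \<mu>low * t - 2 * \<mu>up * sqrt wmax * \<epsilon> \<le> (\<integral>z. excess t z \<partial>joint_law P \<kappa>)"
proof -
  have "2 * \<mu>low * t - 2 * \<mu>up * sqrt wmax * \<epsilon> \<le> (\<integral>x. w x * (2 * \<mu>low * t + (- \<mu>up) * gap x) \<partial>P)"
    unfolding integral_affine_gap using mult_left_mono[OF integral_w_gap, of \<mu>up] \<mu>up_pos by simp
  also have "\<dots> \<le> (\<integral>z. excess t z \<partial>joint_law P \<kappa>)"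
    unfolding integral_excess
  proof (rule integral_mono_AE[OF integral_affine_gap(2) integrable_interval_prob], rule AE_I2)
    fix x assume x: "x \<in> space P"
    then obtain p where "two_sided_density_level (\<kappa> x) p \<mu>low \<mu>up M \<alpha> (q1 x) (q2 x)"
      using conditional_law[of x] by auto
    then interpret two_sided_density_level "\<kappa> x" p \<mu>low \<mu>up M \<alpha> "q1 x" "q2 x" .
    show "w x * (2 * \<mu>low * t + (- \<mu>up) * gap x) \<le> w x * (measure (\<kappa> x) {lo x - t..hi x + t} - (1 - \<alpha>))"
      using prob_widened[of t "lo x" "hi x"] assms gap_bound[of x] x w_bounds
      by (intro mult_left_mono) (auto simp: \<rho>_def)
  qed
  finally show ?thesis .
qed

lemma mean_excess_narrowed:
  assumes "0 \<le> t" "t \<le> \<rho>"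
  shows "(\<integral>z. excess (- t) z \<partial>joint_law P \<kappa>) \<le> 2 * \<mu>up * sqrt wmax * \<epsilon> - 2 * \<mu>low * t"
proof -
  have "(\<integral>z. excess (- t) z \<partial>joint_law P \<kappa>) \<le> (\<integral>x. w x * (- 2 * \<mu>low * t + \<mu>up * gap x) \<partial>P)"
    unfolding integral_excess
  proof (rule integral_mono_AE[OF integrable_interval_prob integral_affine_gap(2)], rule AE_I2)
    fix x assume x: "x \<in> space P"
    then obtain p where "two_sided_density_level (\<kappa> x) p \<mu>low \<mu>up M \<alpha> (q1 x) (q2 x)"
      using conditional_law[of x] by auto
    then interpret two_sided_density_level "\<kappa> x" p \<mu>low \<mu>up M \<alpha> "q1 x" "q2 x" .
    show "w x * (measure (\<kappa> x) {lo x - - t..hi x + - t} - (1 - \<alpha>)) \<le> w x * (- 2 * \<mu>low * t + \<mu>up * gap x)"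
      using prob_narrowed[of t "lo x" "hi x"] assms gap_bound[of x] x w_bounds
      by (intro mult_left_mono) (auto simp: \<rho>_def)
  qed
  also have "\<dots> \<le> 2 * \<mu>up * sqrt wmax * \<epsilon> - 2 * \<mu>low * t"
    unfolding integral_affine_gap using mult_left_mono[OF integral_w_gap, of \<mu>up] \<mu>up_pos by simp
  finally show ?thesis .
qed

end

section \<open>Concentration over the calibration sample\<close>

context fitted_endpoints
begin

text \<open>
  The excess is dominated by the weight, so its variance does not exceed \<open>E w\<^sup>2\<close> at any \<open>t\<close>.
\<close>
lemma integral_excess2: "(\<integral>z. (excess t z)\<^sup>2 \<partial>joint_law P \<kappa>) \<le> 1 + chi2 P w"
  and integrable_excess: "integrable (joint_law P \<kappa>) (excess t)"
  and integrable_excess2: "integrable (joint_law P \<kappa>) (\<lambda>z. (excess t z)\<^sup>2)"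
proof -
  have w2: "\<bar>(w x)\<^sup>2\<bar> \<le> wmax\<^sup>2" if "x \<in> cube" for x
    using w_sq_le[OF that] by simp
  have sq: "(excess t (x, y))\<^sup>2 \<le> (w x)\<^sup>2" if "x \<in> cube" for x y
    using abs_excess_le[OF that, of t y] w_bounds[OF that] by (simp add: abs_le_square_iff[symmetric])
  show "integrable (joint_law P \<kappa>) (excess t)"
    by (rule integrable_joint[OF excess_meas]) (rule order_trans[OF abs_excess_le w_bounds(2)])
  show int: "integrable (joint_law P \<kappa>) (\<lambda>z. (excess t z)\<^sup>2)"
    by (rule integrable_joint[where B = "wmax\<^sup>2"]) (use sq w2 in \<open>force intro: order_trans\<close>)+
  have "(\<integral>z. (excess t z)\<^sup>2 \<partial>joint_law P \<kappa>) \<le> (\<integral>z. (w (fst z))\<^sup>2 \<partial>joint_law P \<kappa>)"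
  proof (rule integral_mono[OF int])
    show "integrable (joint_law P \<kappa>) (\<lambda>z. (w (fst z))\<^sup>2)"
      by (rule integrable_joint[where B = "wmax\<^sup>2"]) (use w2 in auto)
    show "(excess t z)\<^sup>2 \<le> (w (fst z))\<^sup>2" if "z \<in> space (joint_law P \<kappa>)" for z
      using that sq by (cases z) auto
  qed
  also have "\<dots> = (\<integral>x. (\<integral>y. (w x)\<^sup>2 \<partial>\<kappa> x) \<partial>P)"
    by (subst integral_joint[where B = "wmax\<^sup>2"]) (use w2 in auto)
  also have "\<dots> = (\<integral>x. (w x)\<^sup>2 \<partial>P)"
    by (intro Bochner_Integration.integral_cong refl) (use prob_kernel prob_space.prob_space in auto)
  finally show "(\<integral>z. (excess t z)\<^sup>2 \<partial>joint_law P \<kappa>) \<le> 1 + chi2 P w" by (simp add: integral_w2)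
qed

end

locale calibration = fitted_endpoints \<alpha> \<mu>low \<mu>up M wmax P Q \<kappa> w f1 f2 \<epsilon>
  for \<alpha> \<mu>low \<mu>up M wmax :: real and P Q :: "(real ^ 'd::finite) measure"
    and \<kappa> :: "real ^ 'd \<Rightarrow> real measure" and w :: "real ^ 'd \<Rightarrow> real"
    and f1 f2 :: "real ^ 'd \<Rightarrow> real" and \<epsilon> :: real +
  fixes m :: nat and \<delta> :: real
  assumes m: "1 \<le> m" and \<delta>: "0 < \<delta>" "\<delta> < 1"
begin

abbreviation "\<eta> \<equiv> eta_w P w wmax m \<delta>"
text \<open>
  The grid starts at \<open>t0\<close>, where the guaranteed growth \<open>2 \<mu>low t0\<close> is twice the sum of the bias and of
  the permitted deviation \<open>3 \<eta>\<close>; half of it pays for these two, the other half remains.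
\<close>
definition "bias = 2 * \<mu>up * sqrt wmax * \<epsilon>"
definition "t0 = (bias + 3 * \<eta>) / \<mu>low"
abbreviation "V \<equiv> 1 + chi2 P w"

lemma ln_pos: "0 < ln (4 / \<delta>)"
  using \<delta> by (subst ln_gt_zero_iff) auto

lemma V_pos: "0 < V"
  using chi2_nonneg by simp

text \<open>
  The two summands of \<open>\<eta>\<close> serve the variance condition and the range condition of the tail bound.
\<close>
lemma \<eta>_lower: "9 * sqrt (V * ln (4 / \<delta>) / m) \<le> \<eta>" "4 * wmax * ln (4 / \<delta>) / (3 * m) \<le> \<eta>"
  using wmax_ge_1 ln_pos V_pos by (auto simp: eta_w_def)

lemma \<eta>_pos: "0 < \<eta>"
  using \<eta>_lower(1) V_pos ln_pos m by (smt (verit) divide_pos_pos mult_pos_pos of_nat_0_less_iff real_sqrt_gt_0_iff less_le_trans zero_less_one)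

lemma \<eta>_sq: "81 * (V * ln (4 / \<delta>)) \<le> m * \<eta>\<^sup>2"
proof -
  have "(9 * sqrt (V * ln (4 / \<delta>) / m))\<^sup>2 \<le> \<eta>\<^sup>2"
    using \<eta>_lower(1) V_pos ln_pos by (intro power_mono) auto
  then have "81 * (V * ln (4 / \<delta>) / m) \<le> \<eta>\<^sup>2"
    using V_pos ln_pos by (simp add: power_mult_distrib)
  then show ?thesis using m by (simp add: field_simps)
qed

lemma bias_pos: "0 < bias"
  using \<mu>up_pos wmax_ge_1 \<epsilon>_pos by (simp add: bias_def)

lemma t0_pos: "0 < t0"
  using bias_pos \<eta>_pos \<mu>low_pos by (simp add: t0_def)

text \<open>
  The exponents double along the grid, so the failure probabilities are summable over infinitely many
  grid points.
\<close>
lemma exp_neg_log_le: "exp (- (2 * 2 ^ k * ln (4 / \<delta>))) \<le> \<delta> / 16 * (1 / 4) ^ k"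
proof -
  have "exp (- (2 * 2 ^ k * ln (4 / \<delta>))) = exp (real (2 * 2 ^ k) * ln (\<delta> / 4))"
    using \<delta> by (simp add: ln_div algebra_simps)
  also have "\<dots> = (\<delta> / 4) ^ (2 * 2 ^ k)"
    using \<delta> by (simp only: exp_of_nat_mult) simp
  also have "\<dots> \<le> (\<delta> / 4) ^ Suc (Suc k)"
  proof (rule power_decreasing)
    show "Suc (Suc k) \<le> 2 * 2 ^ k" by (induction k) auto
  qed (use \<delta> in auto)
  also have "\<dots> \<le> (\<delta> / 4) * ((1 / 4) * (1 / 4) ^ k)"
    unfolding power_Suc using \<delta> by (intro mult_left_mono mult_mono power_mono) auto
  finally show ?thesis by simp
qed

text \<open>
  At the \<open>k\<close>-th grid point a deviation of \<open>2\<^sup>k 3 \<eta>\<close> per observation is permitted.  The factor \<open>c\<close> is a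
  sign, for the two tails.  With \<open>3 \<eta>\<close> the range condition holds with equality in the second summand of
  \<open>\<eta>\<close>, for the exponent \<open>2 2\<^sup>k log (4/\<delta>)\<close>.
\<close>
lemma excess_sum_tail:
  assumes mean: "(\<integral>z. c * excess t z \<partial>joint_law P \<kappa>) \<le> \<mu>" and c: "\<bar>c\<bar> = 1"
  shows "measure (sample_law m P \<kappa>) {D \<in> space (sample_law m P \<kappa>).
           real m * (\<mu> + 2 ^ k * (3 * \<eta>)) \<le> (\<Sum>j<m. c * excess t (D j))} \<le> \<delta> / 16 * (1 / 4) ^ k"
proof -
  have c2: "c\<^sup>2 = 1" using c by (metis power2_abs one_power2)
  have "measure (sample_law m P \<kappa>) {D \<in> space (sample_law m P \<kappa>).
           real m * (\<mu> + 2 ^ k * (3 * \<eta>)) \<le> (\<Sum>j<m. c * excess t (D j))} \<le> exp (- (2 * 2 ^ k * ln (4 / \<delta>)))"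
    unfolding sample_law_def
  proof (rule iid_sum_upper_tail[OF prob_joint _ _ _ _ mean, where b = wmax and V = V])
    show "integrable (joint_law P \<kappa>) (\<lambda>z. c * excess t z)"
      using integrable_excess by simp
    show "integrable (joint_law P \<kappa>) (\<lambda>z. (c * excess t z)\<^sup>2)"
         "(\<integral>z. (c * excess t z)\<^sup>2 \<partial>joint_law P \<kappa>) \<le> V"
      using integrable_excess2 integral_excess2 by (simp_all add: power_mult_distrib c2)
    show "c * excess t z \<le> wmax" if "z \<in> space (joint_law P \<kappa>)" for z
    proof -
      have "z \<in> cube \<times> UNIV" using that by simp
      then obtain x y where z: "z = (x, y)" "x \<in> cube" by blast
      have "c * excess t z \<le> \<bar>excess t z\<bar>" using c abs_ge_self[of "c * excess t z"] by (simp add: abs_mult)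
      then show ?thesis using abs_excess_le[of x t y] w_bounds(2)[of x] z by auto
    qed
    show "0 < 2 ^ k * (3 * \<eta>)" using \<eta>_pos by simp
    show "2 * wmax * (2 * 2 ^ k * ln (4 / \<delta>)) \<le> real m * (2 ^ k * (3 * \<eta>))"
      using \<eta>_lower(2) m by (simp add: field_simps)
    have "4 * V * (2 * 2 ^ k * ln (4 / \<delta>)) \<le> 9 * (2 ^ k)\<^sup>2 * (81 * (V * ln (4 / \<delta>)))"
    proof -
      have "8 \<le> 729 * (2::real) ^ k" using one_le_power[of "2::real" k] by linarith
      from mult_right_mono[OF this, of "2 ^ k"] have "8 * (2::real) ^ k \<le> 729 * (2 ^ k)\<^sup>2"
        by (simp add: power2_eq_square)
      from mult_right_mono[OF this, of "V * ln (4 / \<delta>)"] show ?thesis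
        using mult_pos_pos[OF V_pos ln_pos] by (simp add: algebra_simps)
    qed
    also have "\<dots> \<le> 9 * (2 ^ k)\<^sup>2 * (m * \<eta>\<^sup>2)" using \<eta>_sq by (intro mult_left_mono) auto
    finally show "4 * V * (2 * 2 ^ k * ln (4 / \<delta>)) \<le> real m * (2 ^ k * (3 * \<eta>))\<^sup>2"
      by (simp add: power_mult_distrib algebra_simps)
  qed (use wmax_ge_1 V_pos in auto)
  then show ?thesis using exp_neg_log_le[of k] by linarith
qed

text \<open>
  A lower tail of nonnegative variables, hence free of a range condition: the sharp deviation \<open>\<eta>\<close>
  itself is permitted.  This matters, as the size condition that makes all quantiles finite involves
  \<open>\<eta>\<close> with its exact constants.
\<close>
lemma weight_sum_tail:
  "measure (sample_law m P \<kappa>) {D \<in> space (sample_law m P \<kappa>).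
     real m * (- 1 + \<eta>) \<le> (\<Sum>j<m. - w (fst (D j)))} \<le> \<delta> / 16"
proof -
  have w2: "\<bar>(w x)\<^sup>2\<bar> \<le> wmax\<^sup>2" if "x \<in> cube" for x
    using w_sq_le[OF that] by simp
  have "measure (sample_law m P \<kappa>) {D \<in> space (sample_law m P \<kappa>).
     real m * (- 1 + \<eta>) \<le> (\<Sum>j<m. - w (fst (D j)))} \<le> exp (- (2 * ln (4 / \<delta>)))"
    unfolding sample_law_def
  \<comment> \<open>\<open>- w\<close> is nonpositive, so any positive \<open>b\<close> is an upper bound; this one gives equality in the range
    condition.\<close>
  proof (rule iid_sum_upper_tail[OF prob_joint, where b = "m * \<eta> / (4 * ln (4 / \<delta>))" and V = V])
    show "integrable (joint_law P \<kappa>) (\<lambda>z. - w (fst z))"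
      by (rule integrable_joint[where B = wmax]) (use w_bounds in auto)
    show "integrable (joint_law P \<kappa>) (\<lambda>z. (- w (fst z))\<^sup>2)"
      by (rule integrable_joint[where B = "wmax\<^sup>2"]) (use w2 in auto)
    have "(\<integral>z. - w (fst z) \<partial>joint_law P \<kappa>) = (\<integral>x. (\<integral>y. - w x \<partial>\<kappa> x) \<partial>P)"
      by (subst integral_joint[where B = wmax]) (use w_bounds in auto)
    also have "\<dots> = (\<integral>x. - w x \<partial>P)"
      by (intro Bochner_Integration.integral_cong refl) (use prob_kernel prob_space.prob_space in auto)
    finally show "(\<integral>z. - w (fst z) \<partial>joint_law P \<kappa>) \<le> - 1" by (simp add: integral_w)
    have "(\<integral>z. (- w (fst z))\<^sup>2 \<partial>joint_law P \<kappa>) = (\<integral>x. (\<integral>y. (w x)\<^sup>2 \<partial>\<kappa> x) \<partial>P)"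
      by (subst integral_joint[where B = "wmax\<^sup>2"]) (use w2 in auto)
    also have "\<dots> = (\<integral>x. (w x)\<^sup>2 \<partial>P)"
      by (intro Bochner_Integration.integral_cong refl) (use prob_kernel prob_space.prob_space in auto)
    finally show "(\<integral>z. (- w (fst z))\<^sup>2 \<partial>joint_law P \<kappa>) \<le> V" by (simp add: integral_w2)
    show b: "0 < m * \<eta> / (4 * ln (4 / \<delta>))" using m \<eta>_pos ln_pos by simp
    show "- w (fst z) \<le> m * \<eta> / (4 * ln (4 / \<delta>))" if "z \<in> space (joint_law P \<kappa>)" for z
      using that w_bounds(1)[of "fst z"] b by auto
    show "4 * V * (2 * ln (4 / \<delta>)) \<le> real m * \<eta>\<^sup>2"
      using \<eta>_sq mult_pos_pos[OF V_pos ln_pos] by (simp add: algebra_simps)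
    show "2 * (m * \<eta> / (4 * ln (4 / \<delta>))) * (2 * ln (4 / \<delta>)) \<le> real m * \<eta>"
      using ln_pos by simp
  qed (use V_pos \<eta>_pos in auto)
  then show ?thesis using exp_neg_log_le[of 0] by simp
qed

text \<open>
  The calibration samples to which the deterministic quantile bound applies: enough total weight for
  finite quantiles, and the correct sign or growth of the centred sums at \<open>- t0\<close> and on the grid, as
  long as these points lie within the radius \<open>\<rho>\<close>.
\<close>
definition typical_calibration :: "(nat \<Rightarrow> (real ^ 'd) \<times> real) \<Rightarrow> bool" where
  "typical_calibration D \<longleftrightarrow>
     real m * (1 - \<eta>) < (\<Sum>j<m. w (fst (D j))) \<and>
     (t0 \<le> \<rho> \<longrightarrow> (\<Sum>j<m. excess (- t0) (D j)) < 0) \<and>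
     (\<forall>k. 2 ^ k * t0 \<le> \<rho> \<longrightarrow> real m * (\<mu>low * (2 ^ k * t0)) \<le> (\<Sum>j<m. excess (2 ^ k * t0) (D j)))"

text \<open>
  Union bound over one event for the weights, one for \<open>- t0\<close> and one for each grid point, with total
  failure probability at most \<open>\<delta>/16 + \<delta>/16 + \<delta>/12\<close>.
\<close>
lemma typical_calibration_prob:
  "1 - \<delta> / 2 \<le> measure (sample_law m P \<kappa>) {D \<in> space (sample_law m P \<kappa>). typical_calibration D}"
proof -
  let ?S = "sample_law m P \<kappa>"
  interpret S: prob_space ?S by (rule prob_sample_law)
  have [measurable]: "(\<lambda>D. w (fst (D j))) \<in> borel_measurable ?S" if "j \<in> {..<m}" for j
    using that by measurable
  have sets: "{D \<in> space ?S. typical_calibration D} \<in> sets ?S"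
    unfolding typical_calibration_def by measurable
  define B1 where "B1 = {D \<in> space ?S. real m * (- 1 + \<eta>) \<le> (\<Sum>j<m. - w (fst (D j)))}"
  define B2 where "B2 = {D \<in> space ?S. t0 \<le> \<rho> \<and>
      real m * ((bias - 2 * \<mu>low * t0) + 3 * \<eta>) \<le> (\<Sum>j<m. excess (- t0) (D j))}"
  define B3 where "B3 = (\<lambda>k. {D \<in> space ?S. 2 ^ k * t0 \<le> \<rho> \<and>
      real m * ((bias - 2 * \<mu>low * (2 ^ k * t0)) + 2 ^ k * (3 * \<eta>)) \<le> (\<Sum>j<m. - excess (2 ^ k * t0) (D j))})"
  have meas: "B1 \<in> sets ?S" "B2 \<in> sets ?S" "\<And>k. B3 k \<in> sets ?S"
    unfolding B1_def B2_def B3_def by measurable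
  have \<mu>t0: "\<mu>low * t0 = bias + 3 * \<eta>" using \<mu>low_pos by (simp add: t0_def)
  have sub: "{D \<in> space ?S. \<not> typical_calibration D} \<subseteq> (B1 \<union> B2) \<union> (\<Union>k. B3 k)"
  proof
    fix D assume D: "D \<in> {D \<in> space ?S. \<not> typical_calibration D}"
    then consider "\<not> real m * (1 - \<eta>) < (\<Sum>j<m. w (fst (D j)))"
      | "t0 \<le> \<rho>" "\<not> (\<Sum>j<m. excess (- t0) (D j)) < 0"
      | k where "2 ^ k * t0 \<le> \<rho>" "\<not> real m * (\<mu>low * (2 ^ k * t0)) \<le> (\<Sum>j<m. excess (2 ^ k * t0) (D j))"
      unfolding typical_calibration_def by blast
    then show "D \<in> (B1 \<union> B2) \<union> (\<Union>k. B3 k)"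
    proof cases
      case 1
      then have "D \<in> B1" using D by (simp add: B1_def sum_negf algebra_simps)
      then show ?thesis by simp
    next
      case 2
      have "real m * ((bias - 2 * \<mu>low * t0) + 3 * \<eta>) \<le> 0"
        using bias_pos \<eta>_pos \<mu>t0 by (intro mult_nonneg_nonpos) auto
      then have "D \<in> B2" using D 2 by (simp add: B2_def)
      then show ?thesis by simp
    next
      case (3 k)
      have "bias \<le> 2 ^ k * bias" using mult_right_mono[of 1 "2 ^ k" bias] bias_pos by simp
      then have "(bias - 2 * \<mu>low * (2 ^ k * t0)) + 2 ^ k * (3 * \<eta>) \<le> - (\<mu>low * (2 ^ k * t0))"
        using arg_cong[OF \<mu>t0, of "\<lambda>x. 2 ^ k * x"] by (simp add: algebra_simps)
      from mult_left_mono[OF this, of "real m"] have "D \<in> B3 k"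
        using D 3 by (simp add: B3_def sum_negf)
      then show ?thesis by blast
    qed
  qed
  have p1: "measure ?S B1 \<le> \<delta> / 16" unfolding B1_def by (rule weight_sum_tail)
  have p2: "measure ?S B2 \<le> \<delta> / 16"
  proof (cases "t0 \<le> \<rho>")
    case True
    then show ?thesis
      using excess_sum_tail[where c = 1 and k = 0 and t = "-t0" and \<mu> = "bias - 2 * \<mu>low * t0"]
        mean_excess_narrowed[of t0] t0_pos by (simp add: B2_def bias_def)
  qed (use \<delta> in \<open>simp add: B2_def\<close>)
  have p3: "measure ?S (B3 k) \<le> \<delta> / 16 * (1 / 4) ^ k" for k
  proof (cases "2 ^ k * t0 \<le> \<rho>")
    case True
    have "(\<integral>z. -1 * excess (2 ^ k * t0) z \<partial>joint_law P \<kappa>) \<le> bias - 2 * \<mu>low * (2 ^ k * t0)"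
      using mean_excess_widened[of "2 ^ k * t0"] True t0_pos by (simp add: bias_def)
    from excess_sum_tail[OF this, of k] show ?thesis using True by (simp add: B3_def)
  qed (use \<delta> in \<open>simp add: B3_def\<close>)
  have geo: "(\<lambda>k. \<delta> / 16 * (1 / 4) ^ k) sums (\<delta> / 16 * (1 / (1 - 1 / 4)))"
    by (intro sums_mult geometric_sums) simp
  have summ: "summable (\<lambda>k. measure ?S (B3 k))"
    by (rule summable_comparison_test'[OF sums_summable[OF geo], of 0]) (use p3 in simp)
  have "measure ?S (\<Union>k. B3 k) \<le> (\<Sum>k. measure ?S (B3 k))"
    using meas summ by (intro S.finite_measure_subadditive_countably) auto
  also have "\<dots> \<le> (\<Sum>k. \<delta> / 16 * (1 / 4) ^ k)"
    by (rule suminf_le[OF p3 summ sums_summable[OF geo]])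
  also have "\<dots> = \<delta> / 12" using sums_unique[OF geo] by simp
  finally have p3': "measure ?S (\<Union>k. B3 k) \<le> \<delta> / 12" .
  have "measure ?S {D \<in> space ?S. \<not> typical_calibration D} \<le> measure ?S ((B1 \<union> B2) \<union> (\<Union>k. B3 k))"
    using sub meas by (intro S.finite_measure_mono) auto
  also have "\<dots> \<le> (measure ?S B1 + measure ?S B2) + measure ?S (\<Union>k. B3 k)"
    using meas by (intro order_trans[OF measure_Un_le] add_right_mono measure_Un_le) auto
  also have "\<dots> \<le> \<delta> / 2" using p1 p2 p3' \<delta> by simp
  finally have "measure ?S {D \<in> space ?S. \<not> typical_calibration D} \<le> \<delta> / 2" .
  then show ?thesis
    using S.prob_neg[OF sets] by simp
qed

text \<open>
  Within radius \<open>\<rho>\<close> the factor \<open>1\<close> would do; \<open>2 M / \<rho>\<close> covers the points at which only the trivial bound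
  on the quantile is available.
\<close>
definition "trivial_factor = max 1 (2 * M / \<rho>)"

text \<open>
  The size condition \<open>cond\<close> implies \<open>(1 - \<alpha>) w(x) \<le> \<alpha> m (1 - \<eta>)\<close>, because \<open>\<alpha> \<le> 2 - \<alpha>\<close>.  Hence for typical
  samples the atom at infinity has mass less than \<open>\<alpha>\<close>, uniformly in \<open>x\<close>.
\<close>
lemma quantile_bound:
  assumes typical: "typical_calibration D"
    and D: "\<And>j. j < m \<Longrightarrow> fst (D j) \<in> cube" "\<And>j. j < m \<Longrightarrow> snd (D j) \<in> {-M..M}"
    and cond: "(2 - \<alpha>) * \<eta> + (1 - \<alpha>) * wmax / real m \<le> \<alpha>" and x: "x \<in> cube"
  shows "\<exists>q. weighted_quantile \<alpha> w score m D x = ereal q \<and>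
           \<bar>q\<bar> \<le> trivial_factor * (t0 + 2 * (1 - \<alpha>) * w x / (real m * \<mu>low))"
  unfolding trivial_factor_def
proof (rule weighted_quantile_eq_real)
  have W: "real m * (1 - \<eta>) < (\<Sum>j<m. w (fst (D j)))"
    using typical by (simp add: typical_calibration_def)
  have "(1 - \<alpha>) * wmax / real m \<ge> 0" using \<alpha> wmax_ge_1 by simp
  moreover have \<alpha>\<eta>: "\<alpha> * \<eta> \<le> (2 - \<alpha>) * \<eta>" using \<alpha> \<eta>_pos by simp
  ultimately have "\<alpha> * \<eta> \<le> \<alpha> * 1" using cond by linarith
  then have "\<eta> \<le> 1" using \<alpha> by simp
  then show "0 < (\<Sum>j<m. w (fst (D j)))"
    using W by (smt (verit) mult_nonneg_nonneg of_nat_0_le_iff)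
  have "(1 - \<alpha>) * w x \<le> (1 - \<alpha>) * wmax" using w_bounds x \<alpha> by (simp add: mult_left_mono)
  also have "\<dots> \<le> real m * (\<alpha> * (1 - \<eta>))"
  proof -
    have "(1 - \<alpha>) * wmax / real m \<le> \<alpha> * (1 - \<eta>)" using cond \<alpha>\<eta> by (simp add: algebra_simps)
    then show ?thesis using m by (simp add: field_simps)
  qed
  also have "\<dots> \<le> \<alpha> * (\<Sum>j<m. w (fst (D j)))"
    using mult_left_mono[OF less_imp_le[OF W], of \<alpha>] \<alpha> by (simp add: algebra_simps)
  finally show "(1 - \<alpha>) * w x \<le> \<alpha> * (\<Sum>j<m. w (fst (D j)))" .
  show "0 \<le> w (fst (D j))" if "j < m" for j using w_bounds D that by simp
  show "- M \<le> score (fst (D j)) (snd (D j)) \<and> score (fst (D j)) (snd (D j)) \<le> 2 * M" if "j < m" for j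
    using f_bounds[OF D(1)[OF that]] D(2)[OF that] by (auto simp: cqr_score_def)
  show "(\<Sum>j<m. w (fst (D j)) * (indicator {..- t0} (score (fst (D j)) (snd (D j))) - (1 - \<alpha>))) < 0" if "t0 \<le> \<rho>"
    using typical that by (simp add: typical_calibration_def excess_def)
  show "real m * (\<mu>low * (2 ^ k * t0)) \<le>
      (\<Sum>j<m. w (fst (D j)) * (indicator {..2 ^ k * t0} (score (fst (D j)) (snd (D j))) - (1 - \<alpha>)))"
    if "2 ^ k * t0 \<le> \<rho>" for k
    using typical that by (simp add: typical_calibration_def excess_def)
qed (use w_bounds x t0_pos \<rho>_pos \<mu>low_pos M_pos \<alpha> m in auto)

end

section \<open>Length and coverage errors for typical calibration data\<close>

context calibration
begin

text \<open>
  Twice the quantile bound is the affine function \<open>offset + slope w(x)\<close> of the weight, and \<open>radius\<close> is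
  the sum of the L2(Q) bounds for its parts and for the endpoint error.
\<close>
definition "offset = 2 * trivial_factor * t0"
definition "slope = 4 * trivial_factor * (1 - \<alpha>) / (real m * \<mu>low)"
definition "radius = 2 * sqrt wmax * \<epsilon> + offset + slope * sqrt (wmax * V)"

definition error_envelope :: "real ^ 'd \<Rightarrow> real" where
  "error_envelope x = gap x + offset + slope * w x"

lemma envelope_meas [measurable]: "error_envelope \<in> borel_measurable cube_borel"
  unfolding error_envelope_def by measurable

lemma trivial_factor_pos: "0 < trivial_factor" by (simp add: trivial_factor_def)

lemma envelope_coeffs: "0 \<le> offset" "0 \<le> slope"
  using trivial_factor_pos t0_pos \<alpha> \<mu>low_pos by (auto simp: offset_def slope_def)

lemma radius_nonneg: "0 \<le> radius"
  using envelope_coeffs wmax_ge_1 \<epsilon>_pos V_pos by (simp add: radius_def)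

text \<open>
  Under \<open>Q\<close> the second moment of \<open>w\<close> is its third moment under \<open>P\<close>; this is the source of the factor
  \<open>sqrt (wmax V)\<close>.
\<close>
lemma integral_Q_w2: "(\<integral>x. (w x)\<^sup>2 \<partial>Q) \<le> wmax * V"
proof -
  have "(\<integral>x. (w x)\<^sup>2 \<partial>Q) = (\<integral>x. w x * (w x)\<^sup>2 \<partial>P)" by (rule integral_Q) simp
  also have "\<dots> \<le> (\<integral>x. wmax * (w x)\<^sup>2 \<partial>P)"
  proof (rule integral_mono)
    show "integrable P (\<lambda>x. w x * (w x)\<^sup>2)"
    proof (rule integrable_bounded)
      show "\<bar>w x * (w x)\<^sup>2\<bar> \<le> wmax * wmax\<^sup>2" if "x \<in> cube" for x
        using mult_mono[OF w_bounds(2)[OF that] w_sq_le[OF that]] w_bounds(1)[OF that] wmax_ge_1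
        by (simp add: abs_mult)
    qed simp
    show "w x * (w x)\<^sup>2 \<le> wmax * (w x)\<^sup>2" if "x \<in> space P" for x
      using w_bounds that by (intro mult_right_mono) auto
  qed (use integrable_w2 in simp)
  also have "\<dots> = wmax * V" by (simp add: integral_w2)
  finally show ?thesis .
qed

text \<open>
  Squares of threefold sums cost a factor \<open>3 \<le> 2\<^sup>2\<close>, which replaces Minkowski's inequality.
\<close>
lemma envelope_L2: "(\<integral>\<^sup>+ x. ennreal ((error_envelope x)\<^sup>2) \<partial>Q) \<le> ennreal ((2 * radius)\<^sup>2)"
proof -
  have int: "integrable Q (\<lambda>x. (gap x)\<^sup>2)" "integrable Q (\<lambda>x. (w x)\<^sup>2)"
    using gap2_le w_sq_le
    by (auto intro: integrable_Q[where B = "(4 * M)\<^sup>2"] integrable_Q[where B = "wmax\<^sup>2"])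
  have "(\<integral>\<^sup>+ x. ennreal ((error_envelope x)\<^sup>2) \<partial>Q)
      \<le> (\<integral>\<^sup>+ x. ennreal (3 * (gap x)\<^sup>2 + 3 * offset\<^sup>2 + 3 * slope\<^sup>2 * (w x)\<^sup>2) \<partial>Q)"
  proof (intro nn_integral_mono ennreal_leI)
    fix x
    have *: "(a + b + c)\<^sup>2 \<le> 3 * a\<^sup>2 + 3 * b\<^sup>2 + 3 * c\<^sup>2" for a b c :: real
    proof -
      have "0 \<le> (a - b)\<^sup>2 + (b - c)\<^sup>2 + (a - c)\<^sup>2" by simp
      then show ?thesis by (simp add: power2_eq_square algebra_simps)
    qed
    show "(error_envelope x)\<^sup>2 \<le> 3 * (gap x)\<^sup>2 + 3 * offset\<^sup>2 + 3 * slope\<^sup>2 * (w x)\<^sup>2"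
      unfolding error_envelope_def using *[of "gap x" offset "slope * w x"]
      by (simp add: power_mult_distrib mult.assoc)
  qed
  also have "\<dots> = ennreal (\<integral>x. 3 * (gap x)\<^sup>2 + 3 * offset\<^sup>2 + 3 * slope\<^sup>2 * (w x)\<^sup>2 \<partial>Q)"
    using int by (intro nn_integral_eq_integral) auto
  also have "(\<integral>x. 3 * (gap x)\<^sup>2 + 3 * offset\<^sup>2 + 3 * slope\<^sup>2 * (w x)\<^sup>2 \<partial>Q)
      = 3 * (\<integral>x. (gap x)\<^sup>2 \<partial>Q) + 3 * offset\<^sup>2 + 3 * slope\<^sup>2 * (\<integral>x. (w x)\<^sup>2 \<partial>Q)"
    using int Q.prob_space by simp
  also have "ennreal \<dots> \<le> ennreal ((2 * radius)\<^sup>2)"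
  proof (rule ennreal_leI)
    have "(\<integral>x. (gap x)\<^sup>2 \<partial>Q) = (\<integral>x. w x * (gap x)\<^sup>2 \<partial>P)" by (rule integral_Q) simp
    also have "\<dots> \<le> (2 * sqrt wmax * \<epsilon>)\<^sup>2"
      using integral_w_gap2 wmax_ge_1 by (simp add: power_mult_distrib algebra_simps)
    finally have 1: "(\<integral>x. (gap x)\<^sup>2 \<partial>Q) \<le> (2 * sqrt wmax * \<epsilon>)\<^sup>2" .
    have 2: "slope\<^sup>2 * (\<integral>x. (w x)\<^sup>2 \<partial>Q) \<le> (slope * sqrt (wmax * V))\<^sup>2"
      using mult_left_mono[OF integral_Q_w2, of "slope\<^sup>2"] wmax_ge_1 V_pos
      by (simp add: power_mult_distrib)
    have *: "3 * a\<^sup>2 + 3 * b\<^sup>2 + 3 * c\<^sup>2 \<le> (2 * (a + b + c))\<^sup>2" if "0 \<le> a" "0 \<le> b" "0 \<le> c" for a b c :: real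
    proof -
      have "0 \<le> a\<^sup>2 + b\<^sup>2 + c\<^sup>2 + 8 * (a * b + a * c + b * c)" using that by simp
      then show ?thesis by (simp add: power2_eq_square algebra_simps)
    qed
    have "3 * (2 * sqrt wmax * \<epsilon>)\<^sup>2 + 3 * offset\<^sup>2 + 3 * (slope * sqrt (wmax * V))\<^sup>2 \<le> (2 * radius)\<^sup>2"
      unfolding radius_def using wmax_ge_1 \<epsilon>_pos envelope_coeffs V_pos by (intro *) auto
    then show "3 * (\<integral>x. (gap x)\<^sup>2 \<partial>Q) + 3 * offset\<^sup>2 + 3 * slope\<^sup>2 * (\<integral>x. (w x)\<^sup>2 \<partial>Q) \<le> (2 * radius)\<^sup>2"
      using 1 2 by linarith
  qed
  finally show ?thesis .
qed

text \<open>
  Truncation at \<open>0\<close>, which accounts for empty intervals, is a contraction and the oracle values are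
  nonnegative; so length and coverage are Lipschitz in the endpoints even when these cross.
\<close>
lemma interval_errors:
  assumes x: "x \<in> cube" and q: "gap x + 2 * \<bar>q\<bar> \<le> e"
  shows "\<bar>enn2ereal (emeasure lborel {lo x - q..hi x + q}) - enn2ereal (emeasure lborel (oracle_interval \<kappa> \<alpha> x))\<bar> \<le> ereal e"
    and "\<bar>coverage \<kappa> (\<lambda>x. {lo x - q..hi x + q}) x - (1 - \<alpha>)\<bar> \<le> \<mu>up * e"
proof -
  have d: "\<bar>(lo x - q) - q1 x\<bar> + \<bar>(hi x + q) - q2 x\<bar> \<le> e"
    using sorting_contracts[OF x] q by linarith
  obtain p where "two_sided_density_level (\<kappa> x) p \<mu>low \<mu>up M \<alpha> (q1 x) (q2 x)"
    using conditional_law[OF x] by auto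
  then interpret two_sided_density_level "\<kappa> x" p \<mu>low \<mu>up M \<alpha> "q1 x" "q2 x" .
  have "enn2ereal (emeasure lborel {lo x - q..hi x + q}) = ereal (max 0 ((hi x + q) - (lo x - q)))"
    by (auto simp: emeasure_lborel_Icc_eq max_def[of 0] enn2ereal_ennreal zero_ereal_def)
  moreover have "enn2ereal (emeasure lborel (oracle_interval \<kappa> \<alpha> x)) = ereal (q2 x - q1 x)"
    using q1_le_q2 by (simp add: oracle_interval_def enn2ereal_ennreal)
  moreover have "\<bar>max 0 ((hi x + q) - (lo x - q)) - (q2 x - q1 x)\<bar> \<le> e"
  proof -
    have "\<bar>max 0 (b - a) - (b' - a')\<bar> \<le> \<bar>a - a'\<bar> + \<bar>b - b'\<bar>" if "a' \<le> b'" for a b a' b' :: real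
      using that by (simp add: max_def abs_if)
    from this[OF q1_le_q2] d show ?thesis by (rule order_trans)
  qed
  ultimately show "\<bar>enn2ereal (emeasure lborel {lo x - q..hi x + q}) - enn2ereal (emeasure lborel (oracle_interval \<kappa> \<alpha> x))\<bar> \<le> ereal e"
    by (simp only: ereal_minus abs_ereal.simps ereal_less_eq)
  show "\<bar>coverage \<kappa> (\<lambda>x. {lo x - q..hi x + q}) x - (1 - \<alpha>)\<bar> \<le> \<mu>up * e"
    using order_trans[OF prob_perturbed mult_left_mono[OF d]] up_pos by (simp add: coverage_def)
qed

lemma cqr_errors:
  assumes typical: "typical_calibration D"
    and D: "\<And>j. j < m \<Longrightarrow> fst (D j) \<in> cube" "\<And>j. j < m \<Longrightarrow> snd (D j) \<in> {-M..M}"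
    and cond: "(2 - \<alpha>) * \<eta> + (1 - \<alpha>) * wmax / real m \<le> \<alpha>"
  shows "length_error Q (weighted_cqr \<alpha> w f1 f2 m D) (oracle_interval \<kappa> \<alpha>) \<le> ennreal (2 * radius)"
    and "coverage_error Q \<kappa> \<alpha> (weighted_cqr \<alpha> w f1 f2 m D) \<le> ennreal (\<mu>up * (2 * radius))"
proof -
  have pw: "\<bar>enn2ereal (emeasure lborel (weighted_cqr \<alpha> w f1 f2 m D x)) - enn2ereal (emeasure lborel (oracle_interval \<kappa> \<alpha> x))\<bar>
        \<le> ereal (error_envelope x)
      \<and> \<bar>coverage \<kappa> (weighted_cqr \<alpha> w f1 f2 m D) x - (1 - \<alpha>)\<bar> \<le> \<mu>up * error_envelope x"
    if x: "x \<in> cube" for x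
  proof -
    obtain q where q: "weighted_quantile \<alpha> w score m D x = ereal q"
        "\<bar>q\<bar> \<le> trivial_factor * (t0 + 2 * (1 - \<alpha>) * w x / (real m * \<mu>low))"
      using quantile_bound[OF typical D cond x] by auto
    have "weighted_cqr \<alpha> w f1 f2 m D x = {lo x - q..hi x + q}"
      using q(1) by (auto simp: weighted_cqr_def Let_def cqr_score_def)
    moreover have "gap x + 2 * \<bar>q\<bar> \<le> error_envelope x"
    proof -
      have "2 * (trivial_factor * (t0 + 2 * (1 - \<alpha>) * w x / (real m * \<mu>low))) = offset + slope * w x"
        using m \<mu>low_pos by (simp add: offset_def slope_def field_simps)
      then show ?thesis using q(2) by (simp add: error_envelope_def)
    qed
    ultimately show ?thesis using interval_errors[OF x, of q "error_envelope x"] by (simp add: coverage_def)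
  qed
  show "length_error Q (weighted_cqr \<alpha> w f1 f2 m D) (oracle_interval \<kappa> \<alpha>) \<le> ennreal (2 * radius)"
    unfolding length_error_def
    by (rule L2_enorm_le[OF _ envelope_L2]) (use pw radius_nonneg in auto)
  show "coverage_error Q \<kappa> \<alpha> (weighted_cqr \<alpha> w f1 f2 m D) \<le> ennreal (\<mu>up * (2 * radius))"
    unfolding coverage_error_def
  proof (rule L2_enorm_le)
    have "(\<integral>\<^sup>+ x. ennreal ((\<mu>up * error_envelope x)\<^sup>2) \<partial>Q)
        = ennreal (\<mu>up\<^sup>2) * (\<integral>\<^sup>+ x. ennreal ((error_envelope x)\<^sup>2) \<partial>Q)"
      by (subst nn_integral_cmult[symmetric]) (simp_all add: power_mult_distrib ennreal_mult)
    also have "\<dots> \<le> ennreal (\<mu>up\<^sup>2) * ennreal ((2 * radius)\<^sup>2)"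
      by (rule mult_left_mono[OF envelope_L2]) simp
    also have "\<dots> = ennreal ((\<mu>up * (2 * radius))\<^sup>2)"
      by (simp add: ennreal_mult[symmetric] power_mult_distrib)
    finally show "(\<integral>\<^sup>+ x. ennreal ((\<mu>up * error_envelope x)\<^sup>2) \<partial>Q) \<le> ennreal ((\<mu>up * (2 * radius))\<^sup>2)" .
  qed (use pw radius_nonneg \<mu>up_pos in auto)
qed

end

section \<open>Measurability of the errors as functions of the data\<close>

text \<open>
  The mass function is monotone, so the infimum that defines the quantile may be restricted to rational
  arguments.
\<close>
lemma measurable_weighted_quantile:
  assumes "\<And>t. (\<lambda>z. weighted_score_mass w (S z) m (D z) (x z) t) \<in> borel_measurable R"
    and mono: "\<And>z s t. z \<in> space R \<Longrightarrow> s \<le> t \<Longrightarrow>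
       weighted_score_mass w (S z) m (D z) (x z) s \<le> weighted_score_mass w (S z) m (D z) (x z) t"
  shows "(\<lambda>z. weighted_quantile \<alpha> w (S z) m (D z) (x z)) \<in> borel_measurable R"
proof (rule borel_measurableI_less)
  fix y :: ereal
  note assms(1)[measurable]
  let ?F = "\<lambda>z. weighted_score_mass w (S z) m (D z) (x z)"
  have "{z \<in> space R. weighted_quantile \<alpha> w (S z) m (D z) (x z) < y}
      = {z \<in> space R. \<exists>r::rat. 1 - \<alpha> \<le> ?F z (of_rat r) \<and> ereal (of_rat r) < y}"
  proof (intro Collect_cong conj_cong refl iffI)
    fix z assume z: "z \<in> space R"
    assume "weighted_quantile \<alpha> w (S z) m (D z) (x z) < y"
    then obtain t where t: "1 - \<alpha> \<le> ?F z t" "ereal t < y"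
      by (auto simp: weighted_quantile_def INF_less_iff)
    obtain u where u: "t < u" "ereal u < y"
      using ereal_dense2[OF t(2)] by auto
    obtain r where "t < of_rat r" "of_rat r < u" using of_rat_dense[OF u(1)] by auto
    then have "1 - \<alpha> \<le> ?F z (of_rat r)" "ereal (of_rat r) < y"
      using order_trans[OF t(1) mono[OF z]] less_trans[OF _ u(2), of "ereal (of_rat r)"] by auto
    then show "\<exists>r::rat. 1 - \<alpha> \<le> ?F z (of_rat r) \<and> ereal (of_rat r) < y" by blast
  next
    fix z assume "\<exists>r::rat. 1 - \<alpha> \<le> ?F z (of_rat r) \<and> ereal (of_rat r) < y"
    then show "weighted_quantile \<alpha> w (S z) m (D z) (x z) < y"
      by (auto simp: weighted_quantile_def INF_less_iff)
  qed
  also have "\<dots> \<in> sets R" by measurable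
  finally show "{z \<in> space R. weighted_quantile \<alpha> w (S z) m (D z) (x z) < y} \<in> sets R" .
qed

context covariate_shift_model
begin

lemma measurable_L2_enorm:
  assumes [measurable]: "(\<lambda>(D, x). g D x) \<in> borel_measurable (R \<Otimes>\<^sub>M cube_borel)"
  shows "(\<lambda>D. L2_enorm Q (g D)) \<in> borel_measurable R"
proof -
  have "(\<lambda>(D, x). (e2ennreal \<bar>g D x\<bar>)\<^sup>2) \<in> borel_measurable (R \<Otimes>\<^sub>M Q)"
    by measurable
  then have [measurable]: "(\<lambda>D. \<integral>\<^sup>+ x. (e2ennreal \<bar>g D x\<bar>)\<^sup>2 \<partial>Q) \<in> borel_measurable R"
    by (rule Q.borel_measurable_nn_integral)
  show ?thesis unfolding L2_enorm_def Let_def by measurable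
qed

context
  fixes n m :: nat and g1 g2 :: "(nat \<Rightarrow> (real ^ 'd) \<times> real) \<Rightarrow> real ^ 'd \<Rightarrow> real"
  assumes g1 [measurable]: "(\<lambda>(D, x). g1 D x) \<in> borel_measurable ((\<Pi>\<^sub>M i\<in>{..<n}. obs_space) \<Otimes>\<^sub>M cube_borel)"
    and g2 [measurable]: "(\<lambda>(D, x). g2 D x) \<in> borel_measurable ((\<Pi>\<^sub>M i\<in>{..<n}. obs_space) \<Otimes>\<^sub>M cube_borel)"
begin

abbreviation "data \<equiv> (\<Pi>\<^sub>M i\<in>{..<n}. (obs_space :: ((real ^ 'd) \<times> real) measure)) \<Otimes>\<^sub>M (\<Pi>\<^sub>M i\<in>{..<m}. (obs_space :: ((real ^ 'd) \<times> real) measure))"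
abbreviation "S D \<equiv> cqr_score (\<lambda>x. min (g1 D x) (g2 D x)) (\<lambda>x. max (g1 D x) (g2 D x))"
abbreviation "Qhat z \<equiv> weighted_quantile \<alpha> w (S (fst (fst z))) m (snd (fst z)) (snd z)"

lemma score_measurable:
  assumes [measurable]: "D \<in> R \<rightarrow>\<^sub>M (\<Pi>\<^sub>M i\<in>{..<n}. obs_space)" "x \<in> R \<rightarrow>\<^sub>M cube_borel" "y \<in> borel_measurable R"
  shows "(\<lambda>z. S (D z) (x z) (y z)) \<in> borel_measurable R"
proof -
  have [measurable]: "(\<lambda>z. g1 (D z) (x z)) \<in> borel_measurable R" "(\<lambda>z. g2 (D z) (x z)) \<in> borel_measurable R"
    using measurable_compose[OF measurable_Pair[OF assms(1,2)] g1]
      measurable_compose[OF measurable_Pair[OF assms(1,2)] g2] by simp_all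
  show ?thesis unfolding cqr_score_def by measurable
qed

lemma Qhat_measurable: "Qhat \<in> borel_measurable (data \<Otimes>\<^sub>M cube_borel)"
proof (rule measurable_weighted_quantile)
  fix t
  have [measurable]: "(\<lambda>z. snd (fst z) j) \<in> data \<Otimes>\<^sub>M cube_borel \<rightarrow>\<^sub>M obs_space" if "j \<in> {..<m}" for j
    using that by measurable
  have [measurable]: "(\<lambda>z. S (fst (fst z)) (fst (snd (fst z) j)) (snd (snd (fst z) j))) \<in> borel_measurable (data \<Otimes>\<^sub>M cube_borel)"
    if "j \<in> {..<m}" for j
    using that by (intro score_measurable) measurable
  show "(\<lambda>z. weighted_score_mass w (S (fst (fst z))) m (snd (fst z)) (snd z) t) \<in> borel_measurable (data \<Otimes>\<^sub>M cube_borel)"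
    unfolding weighted_score_mass_def by measurable
next
  fix z :: "((nat \<Rightarrow> (real ^ 'd) \<times> real) \<times> (nat \<Rightarrow> (real ^ 'd) \<times> real)) \<times> (real ^ 'd)" and s t :: real
  assume z: "z \<in> space (data \<Otimes>\<^sub>M cube_borel)" and st: "s \<le> t"
  have "fst (snd (fst z) j) \<in> cube" if "j < m" for j
    using z that by (auto simp: space_pair_measure space_PiM PiE_iff mem_Times_iff)
  moreover have "snd z \<in> cube" using z by (auto simp: space_pair_measure)
  ultimately show "weighted_score_mass w (S (fst (fst z))) m (snd (fst z)) (snd z) s
      \<le> weighted_score_mass w (S (fst (fst z))) m (snd (fst z)) (snd z) t"
    unfolding weighted_score_mass_def using w_bounds st
    by (intro sum_mono mult_left_mono divide_nonneg_nonneg add_nonneg_nonneg sum_nonneg) (auto simp: indicator_def)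
qed

text \<open>
  The prediction sets form the sections of one measurable set, so that their Lebesgue measure and their
  conditional probability depend measurably on the data and on the covariate.
\<close>
lemma cqr_graph_sets:
  "(SIGMA z : space (data \<Otimes>\<^sub>M cube_borel).
      weighted_cqr \<alpha> w (g1 (fst (fst z))) (g2 (fst (fst z))) m (snd (fst z)) (snd z))
     \<in> sets ((data \<Otimes>\<^sub>M cube_borel) \<Otimes>\<^sub>M borel)"
proof -
  have [measurable]: "(\<lambda>v. Qhat (fst v)) \<in> borel_measurable ((data \<Otimes>\<^sub>M cube_borel) \<Otimes>\<^sub>M borel)"
    by (rule measurable_compose[OF measurable_fst Qhat_measurable])
  have [measurable]: "(\<lambda>v. S (fst (fst (fst v))) (snd (fst v)) (snd v)) \<in> borel_measurable ((data \<Otimes>\<^sub>M cube_borel) \<Otimes>\<^sub>M borel)"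
    by (rule score_measurable) measurable
  have "(SIGMA z : space (data \<Otimes>\<^sub>M cube_borel).
      weighted_cqr \<alpha> w (g1 (fst (fst z))) (g2 (fst (fst z))) m (snd (fst z)) (snd z))
    = {v \<in> space ((data \<Otimes>\<^sub>M cube_borel) \<Otimes>\<^sub>M borel).
        ereal (S (fst (fst (fst v))) (snd (fst v)) (snd v)) \<le> Qhat (fst v)}"
    by (auto simp: space_pair_measure weighted_cqr_def Let_def)
  also have "\<dots> \<in> sets ((data \<Otimes>\<^sub>M cube_borel) \<Otimes>\<^sub>M borel)" by measurable
  finally show ?thesis .
qed

text \<open>
  Measurability is indispensable here and not a mere formality: \<^const>\<open>measure\<close> assigns \<open>0\<close> to a
  nonmeasurable set.
\<close>
lemma length_error_measurable:
  "(\<lambda>D. length_error Q (weighted_cqr \<alpha> w (g1 (fst D)) (g2 (fst D)) m (snd D)) (oracle_interval \<kappa> \<alpha>)) \<in> borel_measurable data"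
  unfolding length_error_def
proof (rule measurable_L2_enorm)
  have eq: "emeasure lborel (oracle_interval \<kappa> \<alpha> x)
      = ennreal (cond_quantile \<kappa> (1 - \<alpha>/2) x - cond_quantile \<kappa> (\<alpha>/2) x)" for x
    by (auto simp: oracle_interval_def emeasure_lborel_Icc_eq ennreal_neg)
  have [measurable]: "cond_quantile \<kappa> (\<alpha>/2) \<in> borel_measurable cube_borel"
      "cond_quantile \<kappa> (1 - \<alpha>/2) \<in> borel_measurable cube_borel"
    using \<alpha> by (auto intro!: cond_quantile_meas)
  have *: "(\<lambda>z. emeasure lborel (Pair z -` (SIGMA z : space (data \<Otimes>\<^sub>M cube_borel).
      weighted_cqr \<alpha> w (g1 (fst (fst z))) (g2 (fst (fst z))) m (snd (fst z)) (snd z)))) \<in> borel_measurable (data \<Otimes>\<^sub>M cube_borel)"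
    using cqr_graph_sets by (intro lborel.measurable_emeasure_Pair) (simp cong: sets_pair_measure_cong)
  have [measurable]: "(\<lambda>z. emeasure lborel
      (weighted_cqr \<alpha> w (g1 (fst (fst z))) (g2 (fst (fst z))) m (snd (fst z)) (snd z))) \<in> borel_measurable (data \<Otimes>\<^sub>M cube_borel)"
    by (rule iffD1[OF measurable_cong *]) (auto intro!: arg_cong[where f = "emeasure lborel"])
  show "(\<lambda>(D, x). \<bar>enn2ereal (emeasure lborel (weighted_cqr \<alpha> w (g1 (fst D)) (g2 (fst D)) m (snd D) x))
      - enn2ereal (emeasure lborel (oracle_interval \<kappa> \<alpha> x))\<bar>) \<in> borel_measurable (data \<Otimes>\<^sub>M cube_borel)"
    unfolding eq split_beta by measurable
qed

lemma coverage_error_measurable: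
  "(\<lambda>D. coverage_error Q \<kappa> \<alpha> (weighted_cqr \<alpha> w (g1 (fst D)) (g2 (fst D)) m (snd D))) \<in> borel_measurable data"
  unfolding coverage_error_def coverage_def
proof (rule measurable_L2_enorm)
  have "(\<lambda>z. \<kappa> (snd z)) \<in> data \<Otimes>\<^sub>M cube_borel \<rightarrow>\<^sub>M prob_algebra borel"
    by (rule measurable_compose[OF measurable_snd kernel])
  note measure_measurable_prob_algebra2[OF cqr_graph_sets this]
  then show "(\<lambda>(D, x). ereal (measure (\<kappa> x) (weighted_cqr \<alpha> w (g1 (fst D)) (g2 (fst D)) m (snd D) x) - (1 - \<alpha>)))
      \<in> borel_measurable (data \<Otimes>\<^sub>M cube_borel)"
    unfolding split_beta by measurable
qed

end

end

section \<open>The guarantee\<close>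

text \<open>
  The guarantee for arbitrary jointly measurable endpoint estimators with values in \<open>[-M, M]\<close> whose L2(P)
  errors are at most \<open>\<epsilon>\<close> with high probability.
  Independence of the two samples enters through Fubini: for every good training sample the calibration
  event has conditional probability at least \<open>1 - \<delta>/2\<close>, and \<open>(1 - \<delta>/2)\<^sup>2 \<ge> 1 - \<delta>\<close>.
\<close>
theorem (in covariate_shift_model) weighted_cqr_guarantee:
  fixes n m :: nat and g1 g2 :: "(nat \<Rightarrow> (real ^ 'd) \<times> real) \<Rightarrow> real ^ 'd \<Rightarrow> real" and \<epsilon> \<delta> K :: real
  defines "c \<equiv> max 1 (2 * M / (min \<alpha> (1 - \<alpha>) / (2 * \<mu>up)))"
  assumes meas: "(\<lambda>(D, x). g1 D x) \<in> borel_measurable ((\<Pi>\<^sub>M i\<in>{..<n}. obs_space) \<Otimes>\<^sub>M cube_borel)"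
      "(\<lambda>(D, x). g2 D x) \<in> borel_measurable ((\<Pi>\<^sub>M i\<in>{..<n}. obs_space) \<Otimes>\<^sub>M cube_borel)"
    and bdd: "\<And>D x. D \<in> (\<Pi>\<^sub>E i\<in>{..<n}. cube \<times> {-M..M}) \<Longrightarrow> x \<in> cube \<Longrightarrow> \<bar>g1 D x\<bar> \<le> M \<and> \<bar>g2 D x\<bar> \<le> M"
    and \<epsilon>: "0 < \<epsilon>" and m: "1 \<le> m" and \<delta>: "0 < \<delta>" "\<delta> < 1"
    and train1: "1 - \<delta> / 4 \<le> measure (sample_law n P \<kappa>) {D \<in> space (sample_law n P \<kappa>).
        L2_enorm P (\<lambda>x. ereal (g1 D x - cond_quantile \<kappa> (\<alpha>/2) x)) \<le> ennreal \<epsilon>}"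
    and train2: "1 - \<delta> / 4 \<le> measure (sample_law n P \<kappa>) {D \<in> space (sample_law n P \<kappa>).
        L2_enorm P (\<lambda>x. ereal (g2 D x - cond_quantile \<kappa> (1 - \<alpha>/2) x)) \<le> ennreal \<epsilon>}"
    and cond: "(2 - \<alpha>) * eta_w P w wmax m \<delta> + (1 - \<alpha>) * wmax / real m \<le> \<alpha>"
    and K: "2 * (1 + \<mu>up) * (2 * sqrt wmax * \<epsilon>
        + 2 * c * ((2 * \<mu>up * sqrt wmax * \<epsilon> + 3 * eta_w P w wmax m \<delta>) / \<mu>low)
        + 4 * c * (1 - \<alpha>) / (real m * \<mu>low) * sqrt (wmax * (1 + chi2 P w))) \<le> K"
  shows "1 - \<delta> \<le> measure (sample_law n P \<kappa> \<Otimes>\<^sub>M sample_law m P \<kappa>)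
    {(D, D') \<in> space (sample_law n P \<kappa> \<Otimes>\<^sub>M sample_law m P \<kappa>).
       max (length_error Q (weighted_cqr \<alpha> w (g1 D) (g2 D) m D') (oracle_interval \<kappa> \<alpha>))
           (coverage_error Q \<kappa> \<alpha> (weighted_cqr \<alpha> w (g1 D) (g2 D) m D')) \<le> ennreal K}"
proof -
  let ?Tr = "sample_law n P \<kappa>" and ?Ca = "sample_law m P \<kappa>"
  interpret Tr: prob_space ?Tr by (rule prob_sample_law)
  interpret Ca: prob_space ?Ca by (rule prob_sample_law)
  interpret TC: pair_prob_space ?Tr ?Ca ..
  let ?len = "\<lambda>D. length_error Q (weighted_cqr \<alpha> w (g1 (fst D)) (g2 (fst D)) m (snd D)) (oracle_interval \<kappa> \<alpha>)"
  let ?cov = "\<lambda>D. coverage_error Q \<kappa> \<alpha> (weighted_cqr \<alpha> w (g1 (fst D)) (g2 (fst D)) m (snd D))"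
  define E where "E = {D \<in> space (?Tr \<Otimes>\<^sub>M ?Ca). max (?len D) (?cov D) \<le> ennreal K}"
  have [measurable]: "?len \<in> borel_measurable (?Tr \<Otimes>\<^sub>M ?Ca)" "?cov \<in> borel_measurable (?Tr \<Otimes>\<^sub>M ?Ca)"
    using length_error_measurable[OF meas, of m] coverage_error_measurable[OF meas, of m]
      measurable_cong_sets[OF sets_pair_measure_cong[OF sets_sample_law[of n] sets_sample_law[of m]] refl]
    by simp_all
  have E: "E \<in> sets (?Tr \<Otimes>\<^sub>M ?Ca)" unfolding E_def by measurable
  define G1 where "G1 = {D \<in> space ?Tr. L2_enorm P (\<lambda>x. ereal (g1 D x - cond_quantile \<kappa> (\<alpha>/2) x)) \<le> ennreal \<epsilon>}"
  define G2 where "G2 = {D \<in> space ?Tr. L2_enorm P (\<lambda>x. ereal (g2 D x - cond_quantile \<kappa> (1 - \<alpha>/2) x)) \<le> ennreal \<epsilon>}"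
  \<comment> \<open>A set of positive \<^const>\<open>measure\<close> is measurable.\<close>
  have G_sets: "G1 \<in> sets ?Tr" "G2 \<in> sets ?Tr"
    using train1 train2 \<delta> measure_notin_sets[of G1 ?Tr] measure_notin_sets[of G2 ?Tr]
    unfolding G1_def G2_def by fastforce+
  have G_prob: "1 - \<delta> / 2 \<le> measure ?Tr (G1 \<inter> G2)"
  proof -
    have "measure ?Tr (space ?Tr - (G1 \<inter> G2)) \<le> measure ?Tr ((space ?Tr - G1) \<union> (space ?Tr - G2))"
      using G_sets by (intro Tr.finite_measure_mono) auto
    also have "\<dots> \<le> measure ?Tr (space ?Tr - G1) + measure ?Tr (space ?Tr - G2)"
      using G_sets by (intro measure_Un_le) auto
    also have "\<dots> \<le> \<delta> / 2"
      using train1 train2 Tr.prob_compl[OF G_sets(1)] Tr.prob_compl[OF G_sets(2)]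
      unfolding G1_def[symmetric] G2_def[symmetric] by simp
    finally show ?thesis using Tr.prob_compl[of "G1 \<inter> G2"] G_sets by auto
  qed
  have cond_prob: "1 - \<delta> / 2 \<le> measure ?Ca (Pair D -` E)"
    if D: "D \<in> G1 \<inter> G2" and resp: "\<forall>j<n. snd (D j) \<in> {-M..M}" for D
  proof -
    have DS: "D \<in> space ?Tr" using D by (simp add: G1_def)
    then have DP: "D \<in> space (\<Pi>\<^sub>M i\<in>{..<n}. obs_space)"
      using sets_eq_imp_space_eq[OF sets_sample_law] by simp
    have "D \<in> (\<Pi>\<^sub>E i\<in>{..<n}. cube \<times> {-M..M})"
      using DS resp by (auto simp: space_sample_law PiE_iff mem_Times_iff)
    note gb = bdd[OF this]
    have gm [measurable]: "g1 D \<in> borel_measurable cube_borel" "g2 D \<in> borel_measurable cube_borel"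
      using measurable_Pair2[OF meas(1) DP] measurable_Pair2[OF meas(2) DP] by simp_all
    have sq: "(\<integral>x. (g D x - cond_quantile \<kappa> \<tau> x)\<^sup>2 \<partial>P) \<le> \<epsilon>\<^sup>2"
      if "L2_enorm P (\<lambda>x. ereal (g D x - cond_quantile \<kappa> \<tau> x)) \<le> ennreal \<epsilon>"
        and "g D \<in> borel_measurable cube_borel" and "\<And>x. x \<in> cube \<Longrightarrow> \<bar>g D x\<bar> \<le> M"
        and \<tau>: "\<tau> = \<alpha>/2 \<or> \<tau> = 1 - \<alpha>/2" for g \<tau>
    proof (rule L2_enorm_leD[OF that(1)])
      have [measurable]: "g D \<in> borel_measurable cube_borel" "cond_quantile \<kappa> \<tau> \<in> borel_measurable cube_borel"
        using that(2) \<tau> \<alpha> by (auto intro!: cond_quantile_meas)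
      show "integrable P (\<lambda>x. (g D x - cond_quantile \<kappa> \<tau> x)\<^sup>2)"
      proof (rule P.integrable_const_bound[where B = "(2 * M)\<^sup>2"], rule AE_I2)
        fix x assume x: "x \<in> space P"
        have "\<bar>cond_quantile \<kappa> \<tau> x\<bar> \<le> M" using cond_quantile_bounds[of x] x \<tau> by auto
        with that(3)[of x] x have "\<bar>g D x - cond_quantile \<kappa> \<tau> x\<bar> \<le> \<bar>2 * M\<bar>" by simp
        then show "norm ((g D x - cond_quantile \<kappa> \<tau> x)\<^sup>2) \<le> (2 * M)\<^sup>2"
          by (simp only: abs_le_square_iff real_norm_def abs_power2)
      qed measurable
    qed (use \<epsilon> in simp)
    interpret calibration \<alpha> \<mu>low \<mu>up M wmax P Q \<kappa> w "g1 D" "g2 D" \<epsilon> m \<delta>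
    proof unfold_locales
      show "(\<integral>x. (g1 D x - cond_quantile \<kappa> (\<alpha> / 2) x)\<^sup>2 \<partial>P) \<le> \<epsilon>\<^sup>2"
        using D gb gm by (intro sq) (auto simp: G1_def)
      show "(\<integral>x. (g2 D x - cond_quantile \<kappa> (1 - \<alpha> / 2) x)\<^sup>2 \<partial>P) \<le> \<epsilon>\<^sup>2"
        using D gb gm by (intro sq) (auto simp: G2_def)
    qed (use gm gb \<epsilon> m \<delta> in auto)
    have "2 * (1 + \<mu>up) * radius \<le> K"
      using K unfolding radius_def offset_def slope_def trivial_factor_def t0_def bias_def \<rho>_def c_def by simp
    then have "2 * radius + \<mu>up * (2 * radius) \<le> K" by (simp add: algebra_simps)
    moreover have "0 \<le> \<mu>up * (2 * radius)" using radius_nonneg \<mu>up_pos by simp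
    ultimately have rad: "2 * radius \<le> K" "\<mu>up * (2 * radius) \<le> K"
      using radius_nonneg by linarith+
    have "1 - \<delta> / 2 \<le> measure ?Ca {D' \<in> space ?Ca. typical_calibration D'}"
      by (rule typical_calibration_prob)
    also have "\<dots> \<le> measure ?Ca (Pair D -` E)"
    proof (rule Ca.finite_measure_mono_AE)
      show "Pair D -` E \<in> sets ?Ca" using E by (rule sets_Pair1)
      show "AE D' in ?Ca. D' \<in> {D' \<in> space ?Ca. typical_calibration D'} \<longrightarrow> D' \<in> Pair D -` E"
        using AE_sample_response
      proof eventually_elim
        case (elim D')
        show ?case
        proof
          assume D': "D' \<in> {D' \<in> space ?Ca. typical_calibration D'}"
          then have "fst (D' j) \<in> cube" if "j < m" for j
            using that by (auto simp: space_sample_law PiE_iff mem_Times_iff)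
          moreover have "snd (D' j) \<in> {-M..M}" if "j < m" for j using elim that by blast
          ultimately have "?len (D, D') \<le> ennreal (2 * radius)" "?cov (D, D') \<le> ennreal (\<mu>up * (2 * radius))"
            using cqr_errors[of D'] cond D' by auto
          then have "?len (D, D') \<le> ennreal K" "?cov (D, D') \<le> ennreal K"
            using rad by (meson ennreal_leI order_trans)+
          then show "D' \<in> Pair D -` E" using D' DS by (auto simp: E_def space_pair_measure)
        qed
      qed
    qed
    finally show ?thesis .
  qed
  have "ennreal (1 - \<delta>) \<le> ennreal ((1 - \<delta> / 2) * (1 - \<delta> / 2))"
    using \<delta> by (intro ennreal_leI) (simp add: algebra_simps)
  also have "\<dots> \<le> ennreal (1 - \<delta> / 2) * emeasure ?Tr (G1 \<inter> G2)"
    using G_prob \<delta> by (simp add: Tr.emeasure_eq_measure ennreal_mult[symmetric] ennreal_leI mult_left_mono)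
  also have "\<dots> = (\<integral>\<^sup>+ D. ennreal (1 - \<delta> / 2) * indicator (G1 \<inter> G2) D \<partial>?Tr)"
    using G_sets by (subst nn_integral_cmult_indicator) auto
  also have "\<dots> \<le> (\<integral>\<^sup>+ D. emeasure ?Ca (Pair D -` E) \<partial>?Tr)"
  proof (rule nn_integral_mono_AE)
    show "AE D in ?Tr. ennreal (1 - \<delta> / 2) * indicator (G1 \<inter> G2) D \<le> emeasure ?Ca (Pair D -` E)"
      using AE_sample_response
    proof eventually_elim
      case (elim D)
      show ?case using cond_prob[OF _ elim] by (auto simp: indicator_def Ca.emeasure_eq_measure intro!: ennreal_leI)
    qed
  qed
  also have "\<dots> = emeasure (?Tr \<Otimes>\<^sub>M ?Ca) E"
    using Ca.emeasure_pair_measure_alt[OF E] by simp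
  finally have "1 - \<delta> \<le> measure (?Tr \<Otimes>\<^sub>M ?Ca) E"
    using \<delta> by (simp add: TC.emeasure_eq_measure)
  also have "E = {(D, D') \<in> space (?Tr \<Otimes>\<^sub>M ?Ca).
       max (length_error Q (weighted_cqr \<alpha> w (g1 D) (g2 D) m D') (oracle_interval \<kappa> \<alpha>))
           (coverage_error Q \<kappa> \<alpha> (weighted_cqr \<alpha> w (g1 D) (g2 D) m D')) \<le> ennreal K}"
    by (auto simp: E_def)
  finally show ?thesis .
qed


lemma clipped_class_bounded: "f \<in> F_SH \<beta> M n \<Longrightarrow> 0 < M \<Longrightarrow> \<bar>f x\<bar> \<le> M"
  by (auto simp: F_SH_def sparse_class_def clip_def)

text \<open>
  For an empty training sample the endpoint rate would degenerate to \<open>0\<close>.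
\<close>
lemma n_SH_pos: "n_SH d \<beta> H \<le> n \<Longrightarrow> 0 < n"
proof -
  assume n: "n_SH d \<beta> H \<le> n"
  have "0 < max ((\<beta> + 1) powr (2 * \<beta> + real d))
     (max ((H + 1) powr ((2 * \<beta> + real d) / real d) * exp (2 * \<beta> + real d))
          (exp (3 * (2 * \<beta> + real d) / (2 * \<beta>))))"
    by (simp add: less_max_iff_disj)
  then have "0 < n_SH d \<beta> H" unfolding n_SH_def by simp
  then show ?thesis using n by simp
qed

text \<open>
  At level \<open>u = \<delta>/4\<close>, which turns \<open>log (1/u)\<close> into the \<open>log (4/\<delta>)\<close> of the claimed bound.
\<close>
lemma endpoint_rate_bounds:
  assumes "0 < Crate" "0 < Cconf" "0 < n" "0 < \<delta>" "\<delta> < 1"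
  shows "0 < endpoint_rate d \<beta> Crate Cconf n (\<delta> / 4)"
    and "endpoint_rate d \<beta> Crate Cconf n (\<delta> / 4) \<le> (Crate + Cconf) *
      (real n powr (- \<beta> / (2 * \<beta> + real d)) * ln (real n) powr (3/2) + sqrt (ln (4 / \<delta>) / real n))"
proof -
  let ?a = "real n powr (- \<beta> / (2 * \<beta> + real d)) * ln (real n) powr (3/2)"
  let ?b = "sqrt (ln (4 / \<delta>) / real n)"
  have eq: "endpoint_rate d \<beta> Crate Cconf n (\<delta> / 4) = Crate * ?a + Cconf * ?b"
    by (simp add: endpoint_rate_def)
  have "0 < ln (4 / \<delta>)" using assms by (subst ln_gt_zero_iff) auto
  then have b: "0 < ?b" using assms by simp
  have a: "0 \<le> ?a" by simp
  show "0 < endpoint_rate d \<beta> Crate Cconf n (\<delta> / 4)"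
    unfolding eq using a b assms by (intro add_nonneg_pos) auto
  have "0 \<le> Crate * ?b" "0 \<le> Cconf * ?a" using a b assms by auto
  then show "endpoint_rate d \<beta> Crate Cconf n (\<delta> / 4) \<le> (Crate + Cconf) * (?a + ?b)"
    unfolding eq by (simp add: distrib_left distrib_right)
qed

theorem corollary12:
  fixes \<alpha> \<mu>low \<mu>up \<beta> M H Crate Cconf :: real
  assumes "0 < \<alpha>" "\<alpha> < 1" "0 < \<mu>low" "\<mu>low \<le> \<mu>up" "0 < \<beta>" "0 < M"
    and "endpoint_constants TYPE('d::finite) \<alpha> \<mu>low \<mu>up \<beta> M H Crate Cconf"
  shows "\<exists>C>0. \<forall>(P :: (real ^ 'd) measure) \<kappa> Q w wmax ftilde n m \<delta>.
    bounded_model M P \<kappa> \<longrightarrow>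
    density_condition M \<mu>low \<mu>up \<kappa> \<longrightarrow>
    covariate_shift P Q w wmax \<longrightarrow>
    smoothness \<alpha> \<beta> H \<kappa> \<longrightarrow>
    (\<forall>\<tau>\<in>{\<alpha>/2, 1 - \<alpha>/2}. measurable_erm \<beta> M \<tau> n (ftilde \<tau>)) \<longrightarrow>
    0 < \<delta> \<longrightarrow> \<delta> < 1 \<longrightarrow> n \<ge> n_SH CARD('d) \<beta> H \<longrightarrow> m \<ge> 1 \<longrightarrow>
    2 * \<mu>up * sqrt wmax * eps2 CARD('d) \<beta> M H Crate Cconf n (\<delta>/4) + (2 - \<alpha>) * eta_w P w wmax m \<delta>
      < 2 * \<mu>low * r_minus \<alpha> \<mu>up \<longrightarrow>
    2 * \<mu>up * sqrt wmax * eps2 CARD('d) \<beta> M H Crate Cconf n (\<delta>/4) + (2 - \<alpha>) * eta_w P w wmax m \<delta>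
      + (1 - \<alpha>) * wmax / real m \<le> 2 * \<mu>low * r_plus \<alpha> \<mu>up \<longrightarrow>
    (let \<P> = sample_law n P \<kappa> \<Otimes>\<^sub>M sample_law m P \<kappa>;
         Chat = (\<lambda>Dtr Dcal. weighted_cqr \<alpha> w (ftilde (\<alpha>/2) Dtr) (ftilde (1 - \<alpha>/2) Dtr) m Dcal)
     in measure \<P> {(Dtr, Dcal) \<in> space \<P>.
          max (length_error Q (Chat Dtr Dcal) (oracle_interval \<kappa> \<alpha>))
              (coverage_error Q \<kappa> \<alpha> (Chat Dtr Dcal))
          \<le> ennreal (C * (sqrt wmax * (real n powr (- \<beta> / (2 * \<beta> + real CARD('d))) * ln (real n) powr (3/2)
                                      + sqrt (ln (4/\<delta>) / real n))
                         + (2 - \<alpha>) * eta_w P w wmax m \<delta>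
                         + (1 - \<alpha>) / real m * sqrt (wmax * (1 + chi2 P w))))}
        \<ge> 1 - \<delta>)"
proof -
  \<comment> \<open>\<open>K1\<close> and \<open>K2\<close> collect the coefficients of \<open>sqrt wmax \<epsilon>\<close> and of \<open>\<eta>\<close> in the guarantee; \<open>K2\<close> also
    dominates the coefficient \<open>4 c / \<mu>low\<close> of the last term.\<close>
  define c where "c = max 1 (2 * M / (min \<alpha> (1 - \<alpha>) / (2 * \<mu>up)))"
  define K1 where "K1 = 2 + 4 * c * \<mu>up / \<mu>low"
  define K2 where "K2 = 6 * c / \<mu>low"
  define C0 where "C0 = K1 * (Crate + Cconf) + K2"
  define C where "C = 2 * (1 + \<mu>up) * C0"
  have const: "0 < Crate" "0 < Cconf" using assms(7) by (auto simp: endpoint_constants_def)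
  have c: "0 < c" by (simp add: c_def)
  have \<mu>up: "0 < \<mu>up" using assms by linarith
  have K: "0 < K1" "0 < K2" using c \<mu>up assms by (auto simp: K1_def K2_def intro!: add_pos_pos)
  have K2': "4 * c / \<mu>low \<le> K2" using c assms by (simp add: K2_def divide_right_mono)
  have C0: "0 < C0" "K2 \<le> C0" "K1 * (Crate + Cconf) \<le> C0" using K const by (simp_all add: C0_def add_pos_pos)
  show ?thesis
  proof (rule exI[of _ C], intro conjI allI impI)
    show "0 < C" using C0 \<mu>up by (simp add: C_def)
  next
    fix P :: "(real ^ 'd) measure" and \<kappa> Q w wmax n m \<delta>
      and ftilde :: "real \<Rightarrow> (nat \<Rightarrow> (real ^ 'd) \<times> real) \<Rightarrow> real ^ 'd \<Rightarrow> real"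
    assume model: "bounded_model M P \<kappa>" and dens: "density_condition M \<mu>low \<mu>up \<kappa>"
      and shift: "covariate_shift P Q w wmax" and smooth: "smoothness \<alpha> \<beta> H \<kappa>"
      and erm: "\<forall>\<tau>\<in>{\<alpha>/2, 1 - \<alpha>/2}. measurable_erm \<beta> M \<tau> n (ftilde \<tau>)"
      and \<delta>: "0 < \<delta>" "\<delta> < 1" and n: "n_SH CARD('d) \<beta> H \<le> n" and m: "1 \<le> m"
      and cond: "2 * \<mu>up * sqrt wmax * eps2 CARD('d) \<beta> M H Crate Cconf n (\<delta>/4)
          + (2 - \<alpha>) * eta_w P w wmax m \<delta> + (1 - \<alpha>) * wmax / real m \<le> 2 * \<mu>low * r_plus \<alpha> \<mu>up"
    interpret covariate_shift_model \<alpha> \<mu>low \<mu>up M wmax P Q \<kappa> w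
      using assms model dens shift by unfold_locales
    define \<epsilon> where "\<epsilon> = endpoint_rate CARD('d) \<beta> Crate Cconf n (\<delta> / 4)"
    define rate where "rate = real n powr (- \<beta> / (2 * \<beta> + real CARD('d))) * ln (real n) powr (3/2)
                                      + sqrt (ln (4/\<delta>) / real n)"
    define \<eta> where "\<eta> = eta_w P w wmax m \<delta>"
    define Z where "Z = (1 - \<alpha>) / real m * sqrt (wmax * (1 + chi2 P w))"
    note n_pos = n_SH_pos[OF n]
    have \<epsilon>: "0 < \<epsilon>" "\<epsilon> \<le> (Crate + Cconf) * rate"
      using endpoint_rate_bounds[OF const n_pos \<delta>] by (auto simp: \<epsilon>_def rate_def)
    have train: "1 - \<delta> / 4 \<le> measure (sample_law n P \<kappa>) {D \<in> space (sample_law n P \<kappa>).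
        L2_enorm P (\<lambda>x. ereal (ftilde \<tau> D x - cond_quantile \<kappa> \<tau> x)) \<le> ennreal \<epsilon>}"
      if \<tau>: "\<tau> \<in> {\<alpha>/2, 1 - \<alpha>/2}" for \<tau>
    proof -
      have "measurable_erm \<beta> M \<tau> n (ftilde \<tau>)" using erm \<tau> by (rule bspec)
      moreover have "0 < \<delta> / 4" "\<delta> / 4 < 1" using \<delta> by auto
      ultimately show ?thesis
        using assms(7) model dens smooth \<tau> n unfolding endpoint_constants_def \<epsilon>_def by blast
    qed
    have meas: "(\<lambda>(D, x). ftilde \<tau> D x) \<in> borel_measurable ((\<Pi>\<^sub>M i\<in>{..<n}. obs_space) \<Otimes>\<^sub>M cube_borel)"
      and bdd: "\<And>D x. D \<in> (\<Pi>\<^sub>E i\<in>{..<n}. cube \<times> {-M..M}) \<Longrightarrow> \<bar>ftilde \<tau> D x\<bar> \<le> M"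
      if "\<tau> \<in> {\<alpha>/2, 1 - \<alpha>/2}" for \<tau>
      using bspec[OF erm that] M_pos
      by (auto simp: measurable_erm_def intro!: clipped_class_bounded)
    have \<eta>_nonneg: "0 \<le> \<eta>"
    proof -
      have "0 \<le> ln (4 / \<delta>)" using \<delta> by (intro ln_ge_zero) auto
      then show ?thesis using wmax_ge_1 chi2_nonneg by (simp add: \<eta>_def eta_w_def)
    qed
    have cond': "(2 - \<alpha>) * eta_w P w wmax m \<delta> + (1 - \<alpha>) * wmax / real m \<le> \<alpha>"
    proof -
      have "0 \<le> eps2 CARD('d) \<beta> M H Crate Cconf n (\<delta>/4)"
        using \<epsilon>(1) M_pos by (simp add: eps2_def \<epsilon>_def)
      then have "0 \<le> 2 * \<mu>up * sqrt wmax * eps2 CARD('d) \<beta> M H Crate Cconf n (\<delta>/4)"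
        using \<mu>up wmax_ge_1 by simp
      moreover have "2 * \<mu>low * r_plus \<alpha> \<mu>up \<le> \<alpha>"
        using assms \<mu>up by (simp add: r_plus_def r_zero_def field_simps mult_right_mono)
      ultimately show ?thesis using cond by linarith
    qed
    have "1 - \<delta> \<le> measure (sample_law n P \<kappa> \<Otimes>\<^sub>M sample_law m P \<kappa>)
      {(D, D') \<in> space (sample_law n P \<kappa> \<Otimes>\<^sub>M sample_law m P \<kappa>).
         max (length_error Q (weighted_cqr \<alpha> w (ftilde (\<alpha>/2) D) (ftilde (1 - \<alpha>/2) D) m D') (oracle_interval \<kappa> \<alpha>))
             (coverage_error Q \<kappa> \<alpha> (weighted_cqr \<alpha> w (ftilde (\<alpha>/2) D) (ftilde (1 - \<alpha>/2) D) m D'))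
         \<le> ennreal (C * (sqrt wmax * rate + (2 - \<alpha>) * \<eta> + Z))}"
    proof (rule weighted_cqr_guarantee[OF _ _ _ \<epsilon>(1) m \<delta> _ _ cond'])
      have "2 * sqrt wmax * \<epsilon> + 2 * c * ((2 * \<mu>up * sqrt wmax * \<epsilon> + 3 * \<eta>) / \<mu>low)
            + 4 * c * (1 - \<alpha>) / (real m * \<mu>low) * sqrt (wmax * (1 + chi2 P w))
          = K1 * (sqrt wmax * \<epsilon>) + K2 * \<eta> + 4 * c / \<mu>low * Z"
        using m assms(3) by (simp add: K1_def K2_def Z_def field_simps)
      also have "\<dots> \<le> C0 * (sqrt wmax * rate) + C0 * ((2 - \<alpha>) * \<eta>) + C0 * Z"
      proof (intro add_mono)
        have rate: "0 \<le> rate" using \<epsilon> const by (smt (verit) zero_le_mult_iff)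
        have "K1 * (sqrt wmax * \<epsilon>) \<le> K1 * (sqrt wmax * ((Crate + Cconf) * rate))"
          using \<epsilon>(2) K wmax_ge_1 by (intro mult_left_mono) auto
        also have "\<dots> = K1 * (Crate + Cconf) * (sqrt wmax * rate)" by simp
        also have "\<dots> \<le> C0 * (sqrt wmax * rate)"
          using C0(3) wmax_ge_1 rate by (intro mult_right_mono) auto
        finally show "K1 * (sqrt wmax * \<epsilon>) \<le> C0 * (sqrt wmax * rate)" .
        have "1 * \<eta> \<le> (2 - \<alpha>) * \<eta>" using assms(2) \<eta>_nonneg by (intro mult_right_mono) auto
        then show "K2 * \<eta> \<le> C0 * ((2 - \<alpha>) * \<eta>)"
          using C0(1,2) K \<eta>_nonneg by (intro mult_mono) auto
        have "0 \<le> Z" using assms(2) wmax_ge_1 chi2_nonneg by (simp add: Z_def)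
        then show "4 * c / \<mu>low * Z \<le> C0 * Z"
          using K2' C0(2) by (intro mult_right_mono) auto
      qed
      finally have "2 * sqrt wmax * \<epsilon> + 2 * c * ((2 * \<mu>up * sqrt wmax * \<epsilon> + 3 * \<eta>) / \<mu>low)
            + 4 * c * (1 - \<alpha>) / (real m * \<mu>low) * sqrt (wmax * (1 + chi2 P w))
          \<le> C0 * (sqrt wmax * rate + (2 - \<alpha>) * \<eta> + Z)" by (simp add: distrib_left)
      from mult_left_mono[OF this, of "2 * (1 + \<mu>up)"]
      show "2 * (1 + \<mu>up) * (2 * sqrt wmax * \<epsilon>
        + 2 * max 1 (2 * M / (min \<alpha> (1 - \<alpha>) / (2 * \<mu>up))) * ((2 * \<mu>up * sqrt wmax * \<epsilon> + 3 * eta_w P w wmax m \<delta>) / \<mu>low)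
        + 4 * max 1 (2 * M / (min \<alpha> (1 - \<alpha>) / (2 * \<mu>up))) * (1 - \<alpha>) / (real m * \<mu>low) * sqrt (wmax * (1 + chi2 P w)))
        \<le> C * (sqrt wmax * rate + (2 - \<alpha>) * \<eta> + Z)"
        using \<mu>up unfolding c_def[symmetric] \<eta>_def[symmetric] C_def by (simp add: mult.assoc)
    qed (use meas bdd train in auto)
    then show "let \<P> = sample_law n P \<kappa> \<Otimes>\<^sub>M sample_law m P \<kappa>;
         Chat = (\<lambda>Dtr Dcal. weighted_cqr \<alpha> w (ftilde (\<alpha>/2) Dtr) (ftilde (1 - \<alpha>/2) Dtr) m Dcal)
     in measure \<P> {(Dtr, Dcal) \<in> space \<P>.
          max (length_error Q (Chat Dtr Dcal) (oracle_interval \<kappa> \<alpha>))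
              (coverage_error Q \<kappa> \<alpha> (Chat Dtr Dcal))
          \<le> ennreal (C * (sqrt wmax * (real n powr (- \<beta> / (2 * \<beta> + real CARD('d))) * ln (real n) powr (3/2)
                                      + sqrt (ln (4/\<delta>) / real n))
                         + (2 - \<alpha>) * eta_w P w wmax m \<delta>
                         + (1 - \<alpha>) / real m * sqrt (wmax * (1 + chi2 P w))))}
        \<ge> 1 - \<delta>"
      unfolding Let_def rate_def \<eta>_def Z_def .
  qed
qed

end
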